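(* Let $n\ge 5$ be an integer. Then $ex_{\mathcal{P}}(n,\Theta_4^+)=ex_{\mathcal{P}}(n,\Theta_4)$ if $n\ge 6$, and $ex_{\mathcal{P}}(5,\Theta_4^+)=ex_{\mathcal{P}}(5,\Theta_4)+1=7$.
   Context: All graphs are finite and simple. $\Theta_4$ is the family of Theta graphs on 4 vertices, i.e. graphs obtained from $C_4$ by adding one chord; it consists of a single graph ($K_4$ minus an edge). For a graph $H$, $H^+$ denotes the graph obtained from $H$ by adding exactly one pendant edge (joining a new vertex) to a vertex of degree two, and $\Theta_4^+=\{H^+ : H\in\Theta_4\}$. For a family $\mathcal{F}$, $ex_{\mathcal{P}}(n,\mathcal{F})$ is the maximum number of edges in a planar graph on $n$ vertices containing no member of $\mathcal{F}$ as a subgraph. *)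

theory Defs
  imports "HOL-Analysis.Analysis"
begin

type_synonym 'a graph = "'a set \<times> 'a set set"

abbreviation verts :: "'a graph \<Rightarrow> 'a set" where
  "verts \<equiv> fst"

abbreviation edges :: "'a graph \<Rightarrow> 'a set set" where
  "edges \<equiv> snd"

definition simple_graph :: "'a graph \<Rightarrow> bool" where
  "simple_graph G \<longleftrightarrow> finite (verts G) \<and> (\<forall>e\<in>edges G. e \<subseteq> verts G \<and> card e = 2)"

definition vertex_degree :: "'a graph \<Rightarrow> 'a \<Rightarrow> nat" where
  "vertex_degree G v = card {e \<in> edges G. v \<in> e}"

text \<open>\<open>contains_copy G H\<close>: some subgraph of \<open>G\<close>, not necessarily induced, is isomorphic to \<open>H\<close>.\<close>

definition contains_copy :: "'a graph \<Rightarrow> 'b graph \<Rightarrow> bool" where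
  "contains_copy G H \<longleftrightarrow>
     (\<exists>f. inj_on f (verts H) \<and> f ` verts H \<subseteq> verts G \<and> (\<forall>e\<in>edges H. f ` e \<in> edges G))"

text \<open>
  Planarity is topological. In a drawing, vertices are distinct points of the plane
  (the type \<^typ>\<open>complex\<close>), an edge is a simple arc between its two end points that meets
  no further vertex, and two distinct edges meet at most in a common end point.
\<close>

definition plane_drawing :: "'a graph \<Rightarrow> ('a \<Rightarrow> complex) \<Rightarrow> ('a set \<Rightarrow> real \<Rightarrow> complex) \<Rightarrow> bool" where
  "plane_drawing G p \<gamma> \<longleftrightarrow>
     inj_on p (verts G) \<and>
     (\<forall>e\<in>edges G. arc (\<gamma> e) \<and> {pathstart (\<gamma> e), pathfinish (\<gamma> e)} = p ` e \<and>
                  path_image (\<gamma> e) \<inter> p ` verts G = p ` e) \<and>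
     (\<forall>e\<in>edges G. \<forall>e'\<in>edges G. e \<noteq> e' \<longrightarrow>
                  path_image (\<gamma> e) \<inter> path_image (\<gamma> e') \<subseteq> p ` (e \<inter> e'))"

definition planar_graph :: "'a graph \<Rightarrow> bool" where
  "planar_graph G \<longleftrightarrow> (\<exists>p \<gamma>. plane_drawing G p \<gamma>)"

text \<open>
  Every finite graph is isomorphic to one with vertices in \<^typ>\<open>nat\<close>, so it suffices to maximise
  over those. The set is finite, and it is nonempty as soon as every member of the family
  has an edge.
\<close>

definition ex_planar :: "nat \<Rightarrow> nat graph set \<Rightarrow> nat" where
  "ex_planar n \<F> =
     Max {card (edges G) | G :: nat graph.
            simple_graph G \<and> card (verts G) = n \<and> planar_graph G \<and>
            (\<forall>H\<in>\<F>. \<not> contains_copy G H)}"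

text \<open>This is the cycle \<open>C\<^sub>k\<close> for \<open>k \<ge> 3\<close>.\<close>

definition cycle_graph :: "nat \<Rightarrow> nat graph" where
  "cycle_graph k = ({..<k}, (\<lambda>i. {i, Suc i mod k}) ` {..<k})"

text \<open>
  A family of graphs is given by labelled representatives: \<open>theta_graphs 4\<close> has
  two isomorphic members, one for each chord of the 4-cycle.
\<close>

definition theta_graphs :: "nat \<Rightarrow> nat graph set" where
  "theta_graphs k =
     {(verts (cycle_graph k), insert {u, v} (edges (cycle_graph k))) | u v.
        u \<in> verts (cycle_graph k) \<and> v \<in> verts (cycle_graph k) \<and> u \<noteq> v \<and>
        {u, v} \<notin> edges (cycle_graph k)}"

text \<open>All results of attaching one pendant edge \<open>vw\<close>, with \<open>w\<close> a new vertex, at a vertex \<open>v\<close> of degree two.\<close>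

definition pendant_extensions :: "'a graph \<Rightarrow> 'a graph set" where
  "pendant_extensions H =
     {(insert w (verts H), insert {v, w} (edges H)) | v w.
        v \<in> verts H \<and> vertex_degree H v = 2 \<and> w \<notin> verts H}"

definition theta_plus_graphs :: "nat \<Rightarrow> nat graph set" where
  "theta_plus_graphs k = (\<Union>H\<in>theta_graphs k. pendant_extensions H)"

end

theory Submission imports Defs
begin

text \<open>
  Call the theta graph on four vertices a diamond and its pendant extension a kite. In a kite-free
  graph that contains a diamond, either two vertices of the diamond have degree two, or the diamond
  spans a \<open>K\<^sub>4\<close> that is a component. With \<open>f\<close> and \<open>g\<close> the extremal numbers of the diamond and the kite,
  deleting one or two vertices of degree two, or the \<open>K\<^sub>4\<close>, gives \<open>g n \<le> max (g (n - 1) + 2) (g (n - 4) + 6)\<close>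
  unless \<open>g n = f n\<close>, and \<open>g 5 = 7\<close>. On the other hand \<open>f 6 \<ge> 9\<close> by the prism and \<open>f (n + 1) \<ge> f n + 2\<close>,
  so \<open>g n \<le> f n\<close> follows by induction for \<open>n \<ge> 6\<close>.

  For \<open>f (n + 1) \<ge> f n + 2\<close> take three consecutive edges at a vertex \<open>x\<close> of degree at least three. Their
  other ends \<open>u0\<close>, \<open>u1\<close>, \<open>u2\<close> are such that \<open>u1\<close> shares a face with \<open>u0\<close> and with \<open>u2\<close>; without a diamond
  it is not adjacent to both. So there are two nonadjacent vertices on a common face, and a new
  vertex can be joined to them inside the face without creating a triangle.
\<close>

text \<open>Edges are arbitrary arcs and may spiral around their ends, so a drawing has no angular
  order at \<open>x\<close>, and it is not evident that a face reaches a vertex on its boundary by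
  an arc. Hence the drawing is first altered near its vertices until every edge leaves its ends
  along a radius of a small disc. The comparison fails at \<open>n = 5\<close> because three
  triangles on a common edge have 7 edges and no kite, while \<open>f 5 = 6\<close>. The prism
  restores it at \<open>n = 6\<close>, since 9 equals \<open>g 5 + 2\<close>. It also starts the
  bound \<open>f n \<ge> 2 * n - 3\<close>, which has two uses: it exceeds \<open>n\<close>, which
  forces a vertex of degree three, and it settles the \<open>K\<^sub>4\<close> case for
  \<open>n \<le> 9\<close>, where \<open>n - 4\<close> is below the range of the induction. From
  \<open>n = 10\<close> on, the 6 edges of the \<open>K\<^sub>4\<close> are outweighed by the 8
  edges that four extensions gain.\<close>

section \<open>Arcs near their end points\<close>

text \<open>Take the last point \<open>q\<close> of the arc on the circle of radius
  \<open>r\<close>: the tail after \<open>q\<close> never returns to the disc, so the radius to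
  \<open>q\<close> can replace everything before it. Every small \<open>r\<close> is allowed because
  all edges at a vertex must later share one disc; \<open>\<epsilon>\<close> confines the change to
  a neighbourhood of \<open>a\<close>.\<close>

lemma arc_straighten_start:
  fixes g :: "real \<Rightarrow> complex"
  assumes "arc g" "pathstart g = a" "0 < \<epsilon>"
  obtains R where "0 < R" and "\<And>r. 0 < r \<Longrightarrow> r < R \<Longrightarrow>
     \<exists>h q. arc h \<and> pathstart h = a \<and> pathfinish h = pathfinish g \<and> dist a q = r \<and> q \<in> path_image g \<and>
       path_image h \<inter> cball a r = closed_segment a q \<and>
       path_image h \<subseteq> path_image g \<union> cball a r \<and>
       path_image h - ball a \<epsilon> = path_image g - ball a \<epsilon>"
proof -
  have cont: "continuous_on {0..1} g" and inj: "inj_on g {0..1}"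
    using assms by (auto simp: arc_def path_def)
  have g0: "g 0 = a" using assms by (simp add: pathstart_def)
  obtain d where d: "d > 0" "\<And>t. t \<in> {0..1} \<Longrightarrow> dist t 0 < d \<Longrightarrow> dist (g t) (g 0) < \<epsilon>"
    using cont \<open>0 < \<epsilon>\<close> unfolding continuous_on_iff by (metis atLeastAtMost_iff order_refl zero_le_one)
  \<comment> \<open>Up to time \<open>t0\<close> the arc stays within \<open>\<epsilon>\<close> of
    \<open>a\<close>; from then on it keeps a distance of at least \<open>R\<close>. So the last
    crossing of a circle of radius below \<open>R\<close> happens before \<open>t0\<close>.\<close>
  define t0 where "t0 = min (d/2) 1"
  have t0: "0 < t0" "t0 \<le> 1" "\<And>t. 0 \<le> t \<Longrightarrow> t \<le> t0 \<Longrightarrow> dist a (g t) < \<epsilon>"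
    using d g0 by (auto simp: t0_def dist_commute)
  have "closed (g ` {t0..1})"
    using cont t0 by (intro compact_imp_closed compact_continuous_image) (auto intro: continuous_on_subset)
  moreover have "a \<notin> g ` {t0..1}"
  proof
    assume "a \<in> g ` {t0..1}"
    then obtain t where "t \<in> {t0..1}" "g t = g 0" using g0 by auto
    then have "t = 0" using inj t0 by (auto dest: inj_onD)
    with \<open>t \<in> {t0..1}\<close> t0 show False by simp
  qed
  ultimately obtain R where R: "R > 0" "\<And>t. t0 \<le> t \<Longrightarrow> t \<le> 1 \<Longrightarrow> R \<le> dist a (g t)"
    using separate_point_closed[of "g ` {t0..1}" a] by fastforce
  have "R < \<epsilon>" using R(2)[of t0] t0(3)[of t0] t0(1,2) by linarith
  show ?thesis
  proof (rule that[OF R(1)])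
    fix r assume r: "0 < r" "r < R"
    define D where "D t = dist a (g t)" for t
    have contD: "continuous_on {0..1} D" unfolding D_def by (intro continuous_intros cont)
    define T where "T = {t \<in> {0..1}. D t = r}"
    have "closed T" unfolding T_def
      using continuous_closed_preimage_constant[OF contD] by simp
    moreover have "bounded T" by (rule bounded_subset[of "{0..1}"]) (auto simp: T_def)
    ultimately have "compact T" by (simp add: compact_eq_bounded_closed)
    moreover have "T \<noteq> {}"
    proof -
      have "\<exists>x\<ge>0. x \<le> 1 \<and> D x = r"
        using contD r R(2)[of 1] t0 g0 by (intro IVT') (auto simp: D_def)
      then show ?thesis by (auto simp: T_def)
    qed
    ultimately obtain t1 where t1T: "t1 \<in> T" and t1: "\<And>t. t \<in> T \<Longrightarrow> t \<le> t1"
      by (meson compact_attains_sup)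
    have t1': "0 \<le> t1" "t1 \<le> 1" "D t1 = r" using t1T by (auto simp: T_def)
    have "t1 < t0" using R(2)[of t1] r t1' by (force simp: D_def)
    have "t1 \<noteq> 0" using t1' g0 r by (auto simp: D_def)
    have later: "r < D t" if "t1 < t" "t \<le> 1" for t
    proof (rule ccontr)
      assume "\<not> r < D t"
      then have "\<exists>x\<ge>t. x \<le> 1 \<and> D x = r"
        using that t1' r R(2)[of 1] t0
        by (intro IVT' continuous_on_subset[OF contD]) (auto simp: D_def)
      then obtain x where x: "t \<le> x" "x \<le> 1" "D x = r" by auto
      then have "x \<in> T" using that t1' by (auto simp: T_def)
      then show False using t1 x that by force
    qed
    define q where "q = g t1"
    define h where "h = linepath a q +++ subpath t1 1 g"
    have imsub: "path_image (subpath t1 1 g) = g ` {t1..1}"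
      using t1' by (simp add: path_image_subpath)
    have imh: "path_image h = closed_segment a q \<union> g ` {t1..1}"
      unfolding h_def by (subst path_image_join) (auto simp: imsub q_def)
    have dq: "dist a q = r" using t1' by (simp add: q_def D_def)
    have seg: "closed_segment a q \<subseteq> cball a r"
      using dq r by (intro closed_segment_subset) auto
    have tail: "g ` {t1..1} \<inter> cball a r = {q}"
      using later dq t1' by (force simp: D_def q_def less_le)
    have "arc h" unfolding h_def
    proof (rule arc_join)
      show "arc (linepath a q)" using dq r by (intro arc_linepath) auto
      show "arc (subpath t1 1 g)" using assms t1' \<open>t1 < t0\<close> t0 by (intro arc_subpath_arc) auto
      show "path_image (linepath a q) \<inter> path_image (subpath t1 1 g) \<subseteq> {pathstart (subpath t1 1 g)}"
        using seg tail imsub by (auto simp: q_def)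
    qed (simp add: q_def)
    moreover have "pathstart h = a" by (simp add: h_def)
    moreover have "pathfinish h = pathfinish g" using pathfinish_def[of g] by (simp add: h_def)
    moreover have "q \<in> path_image g" using t1' by (auto simp: q_def path_image_def)
    moreover have "path_image h \<inter> cball a r = closed_segment a q"
      using imh seg tail by auto
    moreover have "path_image h \<subseteq> path_image g \<union> cball a r"
      using imh seg t1' by (auto simp: path_image_def)
    moreover have "path_image h - ball a \<epsilon> = path_image g - ball a \<epsilon>"
    proof -
      have "closed_segment a q \<subseteq> ball a \<epsilon>" using seg r \<open>R < \<epsilon>\<close> by force
      moreover have "g ` {0..t1} \<subseteq> ball a \<epsilon>" using t0(3) \<open>t1 < t0\<close> by auto
      moreover have "{0..1} = {0..t1} \<union> {t1..1}" using t1' by auto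
      then have "path_image g = g ` {0..t1} \<union> g ` {t1..1}" by (simp add: path_image_def image_Un)
      ultimately show ?thesis using imh by auto
    qed
    ultimately show "\<exists>h q. arc h \<and> pathstart h = a \<and> pathfinish h = pathfinish g \<and> dist a q = r \<and> q \<in> path_image g \<and>
       path_image h \<inter> cball a r = closed_segment a q \<and>
       path_image h \<subseteq> path_image g \<union> cball a r \<and>
       path_image h - ball a \<epsilon> = path_image g - ball a \<epsilon>" using dq by blast
  qed
qed

text \<open>Keeps the straightened ends of two edges at one vertex apart: they are distinct radii of
  the same disc.\<close>

lemma closed_segment_same_dist:
  fixes a q :: complex
  assumes "dist a q = r" "dist a q' = r" "0 < r" "q \<noteq> q'"
  shows "closed_segment a q \<inter> closed_segment a q' = {a}"
proof -
  have "y = a" if y: "y \<in> closed_segment a q" "y \<in> closed_segment a q'" for y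
  proof -
    obtain s where s: "0 \<le> s" "y = a + s *\<^sub>R (q - a)"
      using y(1) by (auto simp: closed_segment_def algebra_simps)
    obtain t where t: "0 \<le> t" "y = a + t *\<^sub>R (q' - a)"
      using y(2) by (auto simp: closed_segment_def algebra_simps)
    have "dist a y = s * r" using s assms(1) by (simp add: dist_norm norm_minus_commute)
    moreover have "dist a y = t * r" using t assms(2) by (simp add: dist_norm norm_minus_commute)
    ultimately have "s = t" using assms(3) by simp
    then have "s *\<^sub>R (q - a) = s *\<^sub>R (q' - a)" using s t by (metis add_left_cancel)
    then have "s = 0" using assms(4) by simp
    then show ?thesis using s by simp
  qed
  then show ?thesis by auto
qed

text \<open>Cut off the end of \<open>g\<close>: what remains meets \<open>K\<close> in one point only, so by Janiszewski's theorem it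
  does not separate \<open>z\<close> from the removed end in the complement of \<open>K\<close>.\<close>

lemma follow_arc:
  fixes g :: "real \<Rightarrow> complex"
  assumes g: "arc g" and K: "compact K" and gK: "path_image g \<inter> K = {pathstart g, pathfinish g}"
    and m: "m \<in> path_image g" "m \<notin> K" and z: "z \<notin> path_image g"
    and zm: "connected_component (- K) z m" and r: "0 < r"
  obtains s where "s \<in> ball (pathfinish g) r" "connected_component (- (K \<union> path_image g)) z s"
proof -
  let ?b = "pathfinish g"
  let ?L = "K \<union> path_image g"
  have cont: "continuous_on {0..1} g" and inj: "inj_on g {0..1}"
    using g by (auto simp: arc_def path_def)
  obtain d where d: "d > 0" "\<And>t. t \<in> {0..1} \<Longrightarrow> dist t 1 < d \<Longrightarrow> dist (g t) (g 1) < r/2"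
    using cont r unfolding continuous_on_iff
    by (metis atLeastAtMost_iff half_gt_zero order_refl zero_le_one)
  \<comment> \<open>The piece after time \<open>c\<close> is the removed end and lies within
    \<open>r/2\<close> of the end point; the maximum with \<open>1/2\<close> ensures that
    \<open>c\<close> is positive.\<close>
  define c where "c = max (1 - d/2) (1/2)"
  have c: "0 < c" "c < 1" and near: "\<And>t. c \<le> t \<Longrightarrow> t \<le> 1 \<Longrightarrow> dist ?b (g t) < r/2"
    using d by (auto simp: c_def pathfinish_def dist_commute dist_real_def max_def split: if_splits)
  define S where "S = path_image (subpath 0 c g)"
  have S: "S = g ` {0..c}" using c by (simp add: S_def path_image_subpath)
  have arcS: "arc (subpath 0 c g)" using g c by (intro arc_subpath_arc) auto
  define q where "q = g ((c+1)/2)"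
  have injD: "s = t" if "g s = g t" "0 \<le> s" "s \<le> 1" "0 \<le> t" "t \<le> 1" for s t
    using inj that by (auto dest: inj_onD)
  have qS: "q \<notin> S"
  proof
    assume "q \<in> S"
    then obtain t where "0 \<le> t" "t \<le> c" "g ((c+1)/2) = g t" by (auto simp: S q_def)
    then show False using injD[of "(c+1)/2" t] c by simp
  qed
  have qim: "q \<in> path_image g" using c by (auto simp: q_def path_image_def)
  have qK: "q \<notin> K"
  proof
    assume "q \<in> K"
    then have "q = g 0 \<or> q = g 1" using qim gK by (auto simp: pathstart_def pathfinish_def)
    then show False using injD[of "(c+1)/2" 0] injD[of "(c+1)/2" 1] c by (auto simp: q_def)
  qed
  have zK: "z \<in> - K" using zm connected_component_in by blast
  have SK: "S \<inter> K = {pathstart g}"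
  proof -
    have "S \<subseteq> path_image g" using c by (auto simp: S path_image_def)
    moreover have "?b \<notin> S" using injD[of 1] c by (force simp: S pathfinish_def)
    moreover have "pathstart g \<in> S" using c by (auto simp: S pathstart_def)
    ultimately show ?thesis using gK by auto
  qed
  have "connected_component (- (S \<union> K)) z q"
  proof (rule Janiszewski)
    show "compact S" using arcS by (auto simp: S_def compact_arc_image)
    show "closed K" using K compact_imp_closed by blast
    show "connected (S \<inter> K)" by (simp add: SK)
    have "z \<notin> S" using z c by (auto simp: S path_image_def)
    then show "connected_component (- S) z q"
      using connected_arc_complement[OF arcS] qS by (auto simp: S_def connected_iff_connected_component)
    \<comment> \<open>The arc without its ends is connected and avoids \<open>K\<close>, so the
      given point \<open>m\<close> can be exchanged for the point \<open>q\<close> of the removed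
      end.\<close>
    have "connected (path_image g - {pathstart g, pathfinish g})"
      using g by (simp add: arc_imp_simple_path connected_simple_path_endless)
    moreover have "path_image g - {pathstart g, pathfinish g} \<subseteq> - K" using gK by auto
    moreover have "q \<in> path_image g - {pathstart g, pathfinish g}" using qK qim gK by auto
    moreover have "m \<in> path_image g - {pathstart g, pathfinish g}" using m gK by auto
    ultimately have "connected_component (- K) m q"
      unfolding connected_component_def by blast
    then show "connected_component (- K) z q" using zm connected_component_trans by metis
  qed
  moreover have "open (- (S \<union> K))"
    unfolding S_def using arcS K by (intro open_Compl closed_Un compact_imp_closed compact_arc_image)
  ultimately have "path_component (- (S \<union> K)) z q" by (simp add: open_path_connected_component)
  then obtain \<pi> where \<pi>: "path \<pi>" "path_image \<pi> \<subseteq> - (S \<union> K)" "pathstart \<pi> = z" "pathfinish \<pi> = q"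
    unfolding path_component_def by blast
  \<comment> \<open>Any radius strictly between \<open>r/2\<close> and \<open>r\<close> would do.
    The removed end lies inside the smaller disc, so a path that avoids \<open>S\<close> and
    \<open>K\<close> and is stopped on first reaching distance \<open>\<rho>\<close> avoids the
    whole arc, and its last point is still within \<open>r\<close>.\<close>
  define \<rho> where "\<rho> = 3/4 * r"
  have far: "x \<in> - ?L" if "x \<in> - (S \<union> K)" "x \<notin> ball ?b \<rho>" for x
  proof -
    have "x \<notin> g ` {c..1}" using near r that(2) by (force simp: \<rho>_def)
    moreover have "{0..1} = {0..c} \<union> {c..1}" using c by auto
    then have "path_image g = g ` {0..c} \<union> g ` {c..1}" by (simp add: path_image_def image_Un)
    ultimately show ?thesis using that by (auto simp: S)
  qed
  show ?thesis
  proof (cases "z \<in> ball ?b r")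
    case True
    have "connected_component (- ?L) z z" using zK z by (simp add: connected_component_refl)
    then show ?thesis using that True by blast
  next
    case False
    have "pathstart \<pi> \<in> - ball ?b \<rho>" using False \<pi> r by (auto simp: \<rho>_def)
    moreover have "pathfinish \<pi> \<notin> - ball ?b \<rho>" using near[of "(c+1)/2"] \<pi> r c by (auto simp: \<rho>_def q_def)
    moreover have "closed (- ball ?b \<rho>)" by auto
    ultimately obtain h where h: "path h" "pathstart h = pathstart \<pi>" "path_image h \<subseteq> path_image \<pi> \<inter> - ball ?b \<rho>"
         "pathfinish h \<in> frontier (- ball ?b \<rho>)"
      using exists_path_subpath_to_frontier_closed[of "- ball ?b \<rho>" \<pi>] \<pi>(1) by blast
    have "path_image h \<subseteq> - ?L" using far h(3) \<pi>(2) by blast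
    moreover have "z \<in> path_image h" "pathfinish h \<in> path_image h"
      using h(2) \<pi>(3) by (metis pathstart_in_path_image) auto
    ultimately have "connected_component (- ?L) z (pathfinish h)"
      unfolding connected_component_def using connected_path_image[OF h(1)] by blast
    moreover have "pathfinish h \<in> ball ?b r"
      using h(4) r by (auto simp: frontier_complement frontier_ball \<rho>_def)
    ultimately show ?thesis using that by blast
  qed
qed

section \<open>Drawings that are radial near every vertex\<close>

lemma simple_graph_finite_edges: "simple_graph G \<Longrightarrow> finite (edges G)"
  unfolding simple_graph_def by (meson PowI finite_Pow_iff finite_subset subsetI)

lemma simple_graph_edge_subset: "simple_graph G \<Longrightarrow> e \<in> edges G \<Longrightarrow> e \<subseteq> verts G"
  by (simp add: simple_graph_def)

lemma simple_graph_edge_other: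
  assumes "simple_graph G" "e \<in> edges G" "v \<in> e"
  obtains u where "e = {v, u}" "u \<noteq> v" "u \<in> verts G"
proof -
  have "card e = 2" "e \<subseteq> verts G" using assms by (auto simp: simple_graph_def)
  then obtain a b where "e = {a, b}" "a \<noteq> b" by (auto simp: card_2_iff)
  then show ?thesis using that[of a] that[of b] assms(3) \<open>e \<subseteq> verts G\<close> by auto
qed

text \<open>The components of its complement are the faces.\<close>

definition drawing_set :: "'a graph \<Rightarrow> ('a \<Rightarrow> complex) \<Rightarrow> ('a set \<Rightarrow> real \<Rightarrow> complex) \<Rightarrow> complex set" where
  "drawing_set G p \<gamma> = p ` verts G \<union> (\<Union>e\<in>edges G. path_image (\<gamma> e))"

lemma compact_drawing_set:
  assumes "simple_graph G" "plane_drawing G p \<gamma>"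
  shows "compact (drawing_set G p \<gamma>)"
  using assms simple_graph_finite_edges[OF assms(1)] unfolding drawing_set_def
  by (intro compact_Un compact_UN finite_imp_compact finite_imageI compact_arc_image)
     (auto simp: simple_graph_def plane_drawing_def)

text \<open>Inside the disc the drawing is a star of radii, so the edges at \<open>v\<close> have
  angles, and the open sectors between neighbouring radii are free.\<close>

definition radial_at ::
  "'a graph \<Rightarrow> ('a \<Rightarrow> complex) \<Rightarrow> ('a set \<Rightarrow> real \<Rightarrow> complex) \<Rightarrow> 'a \<Rightarrow> real \<Rightarrow> bool" where
  "radial_at G p \<gamma> v r \<longleftrightarrow> 0 < r \<and> p ` verts G \<inter> cball (p v) r = {p v} \<and>
     (\<forall>e\<in>edges G. v \<notin> e \<longrightarrow> path_image (\<gamma> e) \<inter> cball (p v) r = {}) \<and>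
     (\<forall>e\<in>edges G. v \<in> e \<longrightarrow>
        (\<exists>q. dist (p v) q = r \<and> path_image (\<gamma> e) \<inter> cball (p v) r = closed_segment (p v) q))"

lemma edges_meet_in_vertex:
  assumes "simple_graph G" "e \<in> edges G" "e' \<in> edges G" "e \<noteq> e'" "v \<in> e" "v \<in> e'"
  shows "e \<inter> e' = {v}"
proof -
  obtain u where "e = {v, u}" "u \<noteq> v" using simple_graph_edge_other assms by metis
  moreover obtain u' where "e' = {v, u'}" "u' \<noteq> v" using simple_graph_edge_other assms by metis
  ultimately show ?thesis using assms(4) by auto
qed

text \<open>One radius serves all edges at \<open>v\<close>: it lies below the bound from
  \<open>arc_straighten_start\<close> for each of them and below the distance to the set
  \<open>D\<close> of other vertices and edges. Agreement with the old drawing outside the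
  \<open>\<epsilon>\<close>-ball is what allows the vertices to be treated one after
  another.\<close>

lemma straighten_at_vertex:
  assumes G: "simple_graph G" and dr: "plane_drawing G p \<gamma>" and v: "v \<in> verts G" and \<epsilon>: "0 < \<epsilon>"
  obtains \<gamma>' r where "plane_drawing G p \<gamma>'" "radial_at G p \<gamma>' v r"
    "\<And>e. e \<in> edges G \<Longrightarrow> path_image (\<gamma>' e) - ball (p v) \<epsilon> = path_image (\<gamma> e) - ball (p v) \<epsilon>"
proof -
  have inj: "inj_on p (verts G)"
    and arcs: "\<And>e. e \<in> edges G \<Longrightarrow> arc (\<gamma> e)"
    and ends: "\<And>e. e \<in> edges G \<Longrightarrow> {pathstart (\<gamma> e), pathfinish (\<gamma> e)} = p ` e"
    and vert: "\<And>e. e \<in> edges G \<Longrightarrow> path_image (\<gamma> e) \<inter> p ` verts G = p ` e"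
    and disj: "\<And>e e'. e \<in> edges G \<Longrightarrow> e' \<in> edges G \<Longrightarrow> e \<noteq> e' \<Longrightarrow>
       path_image (\<gamma> e) \<inter> path_image (\<gamma> e') \<subseteq> p ` (e \<inter> e')"
    using dr unfolding plane_drawing_def by blast+
  have fin: "finite (edges G)" "finite (verts G)"
    using G simple_graph_finite_edges[OF G] by (auto simp: simple_graph_def)
  define g where "g e = (if pathstart (\<gamma> e) = p v then \<gamma> e else reversepath (\<gamma> e))" for e
  have g: "arc (g e)" "path_image (g e) = path_image (\<gamma> e)" "{pathstart (g e), pathfinish (g e)} = p ` e"
    if "e \<in> edges G" for e
    using arcs[OF that] ends[OF that] by (auto simp: g_def arc_reversepath)
  have gv: "pathstart (g e) = p v" if "e \<in> edges G" "v \<in> e" for e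
  proof -
    have "p v \<in> {pathstart (\<gamma> e), pathfinish (\<gamma> e)}" using ends that by auto
    then show ?thesis by (auto simp: g_def)
  qed
  have "\<exists>R>0. \<forall>r. 0 < r \<longrightarrow> r < R \<longrightarrow> (\<exists>h q. arc h \<and> pathstart h = p v \<and>
       pathfinish h = pathfinish (g e) \<and> dist (p v) q = r \<and> q \<in> path_image (\<gamma> e) \<and>
       path_image h \<inter> cball (p v) r = closed_segment (p v) q \<and>
       path_image h \<subseteq> path_image (\<gamma> e) \<union> cball (p v) r \<and>
       path_image h - ball (p v) \<epsilon> = path_image (\<gamma> e) - ball (p v) \<epsilon>)"
    if "e \<in> edges G" "v \<in> e" for e
    using arc_straighten_start[OF g(1)[OF that(1)] gv[OF that] \<epsilon>] g(2)[OF that(1)] by metis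
  then obtain R where R: "\<And>e. e \<in> edges G \<Longrightarrow> v \<in> e \<Longrightarrow> 0 < R e \<and> (\<forall>r. 0 < r \<longrightarrow> r < R e \<longrightarrow> (\<exists>h q. arc h \<and> pathstart h = p v \<and>
       pathfinish h = pathfinish (g e) \<and> dist (p v) q = r \<and> q \<in> path_image (\<gamma> e) \<and>
       path_image h \<inter> cball (p v) r = closed_segment (p v) q \<and>
       path_image h \<subseteq> path_image (\<gamma> e) \<union> cball (p v) r \<and>
       path_image h - ball (p v) \<epsilon> = path_image (\<gamma> e) - ball (p v) \<epsilon>))"
    by metis
  define D where "D = p ` (verts G - {v}) \<union> (\<Union>e\<in>{e \<in> edges G. v \<notin> e}. path_image (\<gamma> e))"
  have "compact D" unfolding D_def using fin arcs
    by (intro compact_Un compact_UN finite_imp_compact finite_imageI compact_arc_image) auto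
  moreover have "p v \<notin> D"
  proof -
    have "p v \<notin> path_image (\<gamma> e)" if "e \<in> edges G" "v \<notin> e" for e
    proof
      assume "p v \<in> path_image (\<gamma> e)"
      then have "p v \<in> p ` e" using vert[OF that(1)] v by blast
      then show False using inj v that simple_graph_edge_subset[OF G] by (auto dest!: inj_onD)
    qed
    then show ?thesis using inj v by (auto simp: D_def dest: inj_onD)
  qed
  ultimately obtain R0 where R0: "0 < R0" "\<And>x. x \<in> D \<Longrightarrow> R0 \<le> dist (p v) x"
    using separate_point_closed[of D "p v"] compact_imp_closed by metis
  define r where "r = Min (insert R0 (R ` {e \<in> edges G. v \<in> e})) / 2"
  have rpos: "0 < r" unfolding r_def using R0 R fin by auto
  have rless: "r < x" if "x \<in> insert R0 (R ` {e \<in> edges G. v \<in> e})" for x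
  proof -
    have "2 * r \<le> x" unfolding r_def using Min_le[OF _ that] fin by simp
    then show ?thesis using rpos by simp
  qed
  have "\<exists>h q. arc h \<and> pathstart h = p v \<and>
       pathfinish h = pathfinish (g e) \<and> dist (p v) q = r \<and> q \<in> path_image (\<gamma> e) \<and>
       path_image h \<inter> cball (p v) r = closed_segment (p v) q \<and>
       path_image h \<subseteq> path_image (\<gamma> e) \<union> cball (p v) r \<and>
       path_image h - ball (p v) \<epsilon> = path_image (\<gamma> e) - ball (p v) \<epsilon>"
    if "e \<in> edges G" "v \<in> e" for e
    using R[OF that] rpos rless[of "R e"] that by blast
  then obtain h q where h: "\<And>e. e \<in> edges G \<Longrightarrow> v \<in> e \<Longrightarrow> arc (h e) \<and> pathstart (h e) = p v \<and>
       pathfinish (h e) = pathfinish (g e) \<and> dist (p v) (q e) = r \<and> q e \<in> path_image (\<gamma> e) \<and>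
       path_image (h e) \<inter> cball (p v) r = closed_segment (p v) (q e) \<and>
       path_image (h e) \<subseteq> path_image (\<gamma> e) \<union> cball (p v) r \<and>
       path_image (h e) - ball (p v) \<epsilon> = path_image (\<gamma> e) - ball (p v) \<epsilon>"
    by metis
  have hq: "dist (p v) (q e) = r" and him: "path_image (h e) \<inter> cball (p v) r = closed_segment (p v) (q e)"
    and hsub: "path_image (h e) \<subseteq> path_image (\<gamma> e) \<union> cball (p v) r"
    if "e \<in> edges G" "v \<in> e" for e
    using h[OF that] by auto
  define \<gamma>' where "\<gamma>' e = (if v \<in> e then h e else \<gamma> e)" for e
  have Dr: "D \<inter> cball (p v) r = {}" using R0(2) rless[of R0] by force
  have vr: "p ` verts G \<inter> cball (p v) r = {p v}"
  proof -
    have "p ` verts G \<subseteq> insert (p v) D" by (auto simp: D_def)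
    then show ?thesis using Dr v rpos by auto
  qed
  have other: "path_image (\<gamma> e) \<inter> cball (p v) r = {}" if "e \<in> edges G" "v \<notin> e" for e
    using Dr that by (auto simp: D_def)
  have ends': "{pathstart (h e), pathfinish (h e)} = p ` e" if "e \<in> edges G" "v \<in> e" for e
    using h[OF that] g(3)[OF that(1)] gv[OF that] by auto
  have radial: "radial_at G p \<gamma>' v r"
    unfolding radial_at_def
  proof (intro conjI ballI impI)
    show "\<exists>q. dist (p v) q = r \<and> path_image (\<gamma>' e) \<inter> cball (p v) r = closed_segment (p v) q"
      if "e \<in> edges G" "v \<in> e" for e
      using h[OF that] that(2) by (intro exI[of _ "q e"]) (simp add: \<gamma>'_def)
  qed (use rpos vr other in \<open>auto simp: \<gamma>'_def\<close>)
  have "arc (\<gamma>' e) \<and> {pathstart (\<gamma>' e), pathfinish (\<gamma>' e)} = p ` e \<and> path_image (\<gamma>' e) \<inter> p ` verts G = p ` e"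
    if e: "e \<in> edges G" for e
  proof (cases "v \<in> e")
    case False then show ?thesis using arcs[OF e] ends[OF e] vert[OF e] by (simp add: \<gamma>'_def)
  next
    case True
    have "path_image (h e) \<inter> p ` verts G \<subseteq> p ` e"
      using hsub[OF e True] vr vert[OF e] True by blast
    moreover have "p ` e \<subseteq> path_image (h e)"
      unfolding ends'[OF e True, symmetric] by (simp only: insert_subset pathstart_in_path_image pathfinish_in_path_image empty_subsetI simp_thms)
    moreover have "p ` e \<subseteq> p ` verts G" using simple_graph_edge_subset[OF G e] by auto
    ultimately have "path_image (h e) \<inter> p ` verts G = p ` e" by blast
    then show ?thesis using h[OF e True] ends'[OF e True] True by (simp add: \<gamma>'_def)
  qed
  moreover have "path_image (\<gamma>' e) \<inter> path_image (\<gamma>' e') \<subseteq> p ` (e \<inter> e')"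
    if e: "e \<in> edges G" "e' \<in> edges G" "e \<noteq> e'" for e e'
  proof (cases "v \<in> e \<and> v \<in> e'")
    case True
    then have "e \<inter> e' = {v}" using edges_meet_in_vertex[OF G e] by simp
    then have int: "path_image (\<gamma> e) \<inter> path_image (\<gamma> e') \<subseteq> {p v}" using disj[OF e] by simp
    \<comment> \<open>The outer ends of the radii are points of the original edges, which meet only
      in \<open>p v\<close>; this is why the straightening records that \<open>q\<close> lies on the
      old arc.\<close>
    have "q e \<noteq> q e'" 
    proof
      assume "q e = q e'"
      then have "q e = p v" using h[OF e(1)] h[OF e(2)] True int by auto
      then show False using h[OF e(1)] True rpos by auto
    qed
    then have "closed_segment (p v) (q e) \<inter> closed_segment (p v) (q e') = {p v}"
      using closed_segment_same_dist[OF hq[OF e(1)] hq[OF e(2)] rpos] True by simp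
    then have "path_image (h e) \<inter> path_image (h e') \<subseteq> {p v}"
      using him[OF e(1)] him[OF e(2)] hsub[OF e(1)] hsub[OF e(2)] True int by blast
    then show ?thesis using True \<open>e \<inter> e' = {v}\<close> by (simp add: \<gamma>'_def)
  next
    case False
    have "path_image (h e) \<inter> path_image (\<gamma> e') \<subseteq> path_image (\<gamma> e) \<inter> path_image (\<gamma> e')" if "v \<in> e" "v \<notin> e'"
      using hsub[OF e(1) that(1)] other[OF e(2) that(2)] by blast
    moreover have "path_image (\<gamma> e) \<inter> path_image (h e') \<subseteq> path_image (\<gamma> e) \<inter> path_image (\<gamma> e')" if "v \<notin> e" "v \<in> e'"
      using hsub[OF e(2) that(2)] other[OF e(1) that(1)] by blast
    ultimately show ?thesis using disj[OF e] False by (auto simp: \<gamma>'_def)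
  qed
  ultimately have "plane_drawing G p \<gamma>'" using inj unfolding plane_drawing_def by simp
  moreover have "path_image (\<gamma>' e) - ball (p v) \<epsilon> = path_image (\<gamma> e) - ball (p v) \<epsilon>" if "e \<in> edges G" for e
    using h[OF that] by (simp add: \<gamma>'_def)
  ultimately show ?thesis using that[OF _ radial] by simp
qed

text \<open>Induction over the vertices: the straightening at \<open>v\<close> is confined to a ball
  that misses the discs of all vertices treated before, so these stay radial.\<close>

lemma radial_drawing_exists:
  assumes G: "simple_graph G" and dr: "plane_drawing G p \<gamma>"
  obtains \<gamma>' r where "plane_drawing G p \<gamma>'" "\<And>v. v \<in> verts G \<Longrightarrow> radial_at G p \<gamma>' v (r v)"
proof -
  have "\<exists>\<gamma>' r. plane_drawing G p \<gamma>' \<and> (\<forall>v\<in>S. radial_at G p \<gamma>' v (r v))"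
    if "finite S" "S \<subseteq> verts G" for S
    using that
  proof (induction S)
    case empty then show ?case using dr by blast
  next
    case (insert v S)
    then obtain \<gamma>1 r where IH: "plane_drawing G p \<gamma>1" "\<And>u. u \<in> S \<Longrightarrow> radial_at G p \<gamma>1 u (r u)"
      by auto
    have v: "v \<in> verts G" using insert by simp
    define D where "D = (\<Union>u\<in>S. cball (p u) (r u))"
    have "closed D" unfolding D_def using insert by auto
    moreover have "p v \<notin> D"
    proof
      assume "p v \<in> D"
      then obtain u where u: "u \<in> S" "p v \<in> cball (p u) (r u)" by (auto simp: D_def)
      then have "p v = p u" using IH(2)[OF u(1)] v by (auto simp: radial_at_def)
      moreover have "inj_on p (verts G)" using dr by (simp add: plane_drawing_def)
      ultimately have "v = u" using v u insert by (auto dest: inj_onD)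
      then show False using u insert by simp
    qed
    ultimately obtain \<epsilon> where \<epsilon>: "0 < \<epsilon>" "\<And>x. x \<in> D \<Longrightarrow> \<epsilon> \<le> dist (p v) x"
      using separate_point_closed[of D "p v"] by metis
    then have Db: "D \<inter> ball (p v) \<epsilon> = {}" by force
    obtain \<gamma>2 s where \<gamma>2: "plane_drawing G p \<gamma>2" "radial_at G p \<gamma>2 v s"
      "\<And>e. e \<in> edges G \<Longrightarrow> path_image (\<gamma>2 e) - ball (p v) \<epsilon> = path_image (\<gamma>1 e) - ball (p v) \<epsilon>"
      using straighten_at_vertex[OF G IH(1) v \<epsilon>(1)] by metis
    have "radial_at G p \<gamma>2 u (r u)" if "u \<in> S" for u
    proof -
      have "cball (p u) (r u) \<inter> ball (p v) \<epsilon> = {}" using Db that by (auto simp: D_def)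
      then have "path_image (\<gamma>2 e) \<inter> cball (p u) (r u) = path_image (\<gamma>1 e) \<inter> cball (p u) (r u)"
        if "e \<in> edges G" for e using \<gamma>2(3)[OF that] by blast
      then show ?thesis using IH(2)[OF that] by (simp add: radial_at_def)
    qed
    moreover have "v \<notin> S" using insert by simp
    ultimately have "\<forall>u\<in>insert v S. radial_at G p \<gamma>2 u ((r(v := s)) u)" using \<gamma>2(2) by auto
    then show ?case using \<gamma>2(1) by blast
  qed
  moreover have "finite (verts G)" using G by (simp add: simple_graph_def)
  ultimately obtain \<gamma>' r where "plane_drawing G p \<gamma>'" "\<forall>v\<in>verts G. radial_at G p \<gamma>' v (r v)"
    by blast
  then show ?thesis using that by blast
qed

section \<open>Reaching vertices from inside a face\<close>

text \<open>The last piece of the curve from \<open>z\<close> to \<open>a\<close> can be taken straight because drawings will be radial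
  near their vertices.\<close>

definition accessible :: "complex set \<Rightarrow> complex \<Rightarrow> complex \<Rightarrow> bool" where
  "accessible K z a \<longleftrightarrow> (\<exists>s. connected_component (- K) z s \<and> closed_segment a s \<inter> K = {a})"

lemma closed_segment_point:
  fixes a :: complex
  assumes "y \<in> closed_segment a b"
  obtains t where "0 \<le> t" "t \<le> 1" "y = a + t *\<^sub>R (b - a)"
proof -
  obtain t where t: "0 \<le> t" "t \<le> 1" "y = (1 - t) *\<^sub>R a + t *\<^sub>R b"
    using assms by (auto simp: closed_segment_def)
  then have "y = a + t *\<^sub>R (b - a)" by (simp add: algebra_simps)
  then show ?thesis using that t by blast
qed

text \<open>If the segment to \<open>s\<close> met the star away from the centre, it would run along
  a radius; as \<open>s\<close> is closer to the centre than the outer end of that radius,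
  \<open>s\<close> itself would belong to the drawing.\<close>

lemma radial_segment:
  assumes v: "v \<in> verts G" and rad: "radial_at G p \<gamma> v r" and s: "s \<in> ball (p v) r" "s \<notin> drawing_set G p \<gamma>"
  shows "closed_segment (p v) s \<inter> drawing_set G p \<gamma> = {p v}"
proof -
  have r: "0 < r" using rad by (simp add: radial_at_def)
  have sub: "closed_segment (p v) s \<subseteq> cball (p v) r"
    using s r by (intro closed_segment_subset) auto
  have "y = p v" if y: "y \<in> closed_segment (p v) s" "y \<in> drawing_set G p \<gamma>" for y
  proof (rule ccontr)
    assume ne: "y \<noteq> p v"
    have yb: "y \<in> cball (p v) r" using y sub by auto
    then have "y \<notin> p ` verts G" using rad ne by (auto simp: radial_at_def)
    then obtain e where e: "e \<in> edges G" "y \<in> path_image (\<gamma> e)" using y by (auto simp: drawing_set_def)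
    then have "v \<in> e" using rad yb unfolding radial_at_def by blast
    then obtain q where q: "dist (p v) q = r" "path_image (\<gamma> e) \<inter> cball (p v) r = closed_segment (p v) q"
      using rad e unfolding radial_at_def by blast
    have "y \<in> closed_segment (p v) q" using q(2) e(2) yb by blast
    then obtain t where t: "0 \<le> t" "t \<le> 1" "y = p v + t *\<^sub>R (q - p v)"
      by (rule closed_segment_point)
    obtain u where u: "0 \<le> u" "u \<le> 1" "y = p v + u *\<^sub>R (s - p v)"
      by (rule closed_segment_point[OF y(1)])
    have "u \<noteq> 0" using u ne by auto
    have eq: "t *\<^sub>R (q - p v) = u *\<^sub>R (s - p v)" using t(3) u(3) by simp
    then have "norm (t *\<^sub>R (q - p v)) = norm (u *\<^sub>R (s - p v))" by simp
    then have nrm: "t * r = u * norm (s - p v)"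
      using t(1) u(1) q(1) by (simp add: dist_norm norm_minus_commute)
    have "norm (s - p v) \<le> r" using s(1) by (simp add: dist_norm norm_minus_commute)
    \<comment> \<open>The common point has parameter \<open>t\<close> on the radius and
      \<open>u\<close> on the segment; comparing lengths gives \<open>t \<le> u\<close>, so
      \<open>s\<close> has the admissible parameter \<open>t/u\<close> on the radius.\<close>
    then have "t * r \<le> u * r" using nrm u(1) by (simp add: mult_left_mono)
    then have "t \<le> u" using r by simp
    have "(t/u) *\<^sub>R (q - p v) = (1/u) *\<^sub>R (t *\<^sub>R (q - p v))" by simp
    also have "\<dots> = s - p v" unfolding eq using \<open>u \<noteq> 0\<close> by simp
    finally have "s - p v = (t/u) *\<^sub>R (q - p v)" by simp
    then have "s = (1 - t/u) *\<^sub>R p v + (t/u) *\<^sub>R q" by (simp add: algebra_simps)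
    moreover have "0 \<le> t/u" "t/u \<le> 1" using \<open>t \<le> u\<close> \<open>u \<noteq> 0\<close> u(1) t(1) by auto
    ultimately have "s \<in> closed_segment (p v) q" unfolding closed_segment_def by blast
    then have "s \<in> path_image (\<gamma> e)" using q(2) by auto
    then show False using s(2) e(1) by (auto simp: drawing_set_def)
  qed
  then show ?thesis using v by (auto simp: drawing_set_def)
qed

text \<open>If \<open>z\<close> reaches an interior point \<open>m\<close> of the edge once the edge
  is erased, its face lies alongside the edge. Following the edge within that face leads into the
  disc around \<open>p u\<close>, and a straight segment completes the way.\<close>

lemma accessible_along_edge:
  assumes G: "simple_graph G" and dr: "plane_drawing G p \<gamma>" and e: "e \<in> edges G" "u \<in> e"
    and rad: "radial_at G p \<gamma> u r" and z: "z \<notin> path_image (\<gamma> e)"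
    and m: "m \<in> path_image (\<gamma> e)" "m \<notin> p ` e"
    and zm: "connected_component (- (p ` verts G \<union> (\<Union>e'\<in>edges G - {e}. path_image (\<gamma> e')))) z m"
  shows "accessible (drawing_set G p \<gamma>) z (p u)"
proof -
  let ?K = "p ` verts G \<union> (\<Union>e'\<in>edges G - {e}. path_image (\<gamma> e'))"
  have ends: "{pathstart (\<gamma> e), pathfinish (\<gamma> e)} = p ` e" and arc: "arc (\<gamma> e)"
    and vert: "path_image (\<gamma> e) \<inter> p ` verts G = p ` e"
    using dr e(1) by (auto simp: plane_drawing_def)
  have u: "u \<in> verts G" using e simple_graph_edge_subset[OF G] by auto
  have r: "0 < r" using rad by (simp add: radial_at_def)
  \<comment> \<open>\<open>follow_arc\<close> moves towards the final point, so the edge is directed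
    towards \<open>u\<close>, which may be either of its ends.\<close>
  define g where "g = (if pathfinish (\<gamma> e) = p u then \<gamma> e else reversepath (\<gamma> e))"
  have "p u \<in> {pathstart (\<gamma> e), pathfinish (\<gamma> e)}" unfolding ends using e(2) by (rule imageI)
  then have "pathfinish g = p u" by (auto simp: g_def)
  moreover have "{pathstart g, pathfinish g} = {pathstart (\<gamma> e), pathfinish (\<gamma> e)}" by (auto simp: g_def)
  ultimately have g: "arc g" "path_image g = path_image (\<gamma> e)" "{pathstart g, pathfinish g} = p ` e" "pathfinish g = p u"
    using arc ends by (auto simp: g_def arc_reversepath)
  have "compact ?K"
    using G dr simple_graph_finite_edges[OF G]
    by (intro compact_Un compact_UN finite_imp_compact finite_imageI compact_arc_image)
       (auto simp: simple_graph_def plane_drawing_def)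
  moreover have gK: "path_image g \<inter> ?K = {pathstart g, pathfinish g}"
  proof -
    have "path_image (\<gamma> e) \<inter> path_image (\<gamma> e') \<subseteq> p ` e" if "e' \<in> edges G - {e}" for e'
      using dr e(1) that unfolding plane_drawing_def by blast
    then have "path_image g \<inter> (\<Union>e'\<in>edges G - {e}. path_image (\<gamma> e')) \<subseteq> p ` e"
      unfolding g(2) by (intro subsetI, elim IntE UN_E) (rule subsetD, assumption, rule IntI)
    moreover have "path_image g \<inter> p ` verts G = p ` e" unfolding g(2) by (rule vert)
    ultimately show ?thesis unfolding g(3) Int_Un_distrib by (simp only: Un_absorb2)
  qed
  moreover have "m \<notin> ?K" using gK m unfolding g(2,3) by (metis IntI)
  ultimately obtain s where s: "s \<in> ball (pathfinish g) r" "connected_component (- (?K \<union> path_image g)) z s"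
    using follow_arc[OF g(1) _ gK, of m z r] m(1) z zm r unfolding g(2) by blast
  have eqK: "?K \<union> path_image g = drawing_set G p \<gamma>" using e(1) g(2) by (auto simp: drawing_set_def)
  have "s \<notin> drawing_set G p \<gamma>" using s(2) eqK connected_component_in[of _ z s] by blast
  then have "closed_segment (p u) s \<inter> drawing_set G p \<gamma> = {p u}"
    using radial_segment[OF u rad] s(1) g(4) by simp
  then show ?thesis using s(2) eqK unfolding accessible_def by metis
qed

text \<open>Two final segments are joined by a path inside the face.\<close>

lemma accessible_arc:
  assumes K: "closed K" and a: "accessible K z a" and b: "accessible K z b" and ab: "a \<noteq> b"
  obtains h where "arc h" "pathstart h = a" "pathfinish h = b" "path_image h \<inter> K = {a, b}"
proof -
  obtain s where s: "connected_component (- K) z s" "closed_segment a s \<inter> K = {a}"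
    using a by (auto simp: accessible_def)
  obtain t where t: "connected_component (- K) z t" "closed_segment b t \<inter> K = {b}"
    using b by (auto simp: accessible_def)
  have "connected_component (- K) s t"
    using s t connected_component_trans connected_component_sym by metis
  then have "path_component (- K) s t" using K by (simp add: open_path_connected_component open_Compl)
  then obtain c where c: "path c" "path_image c \<subseteq> - K" "pathstart c = s" "pathfinish c = t"
    unfolding path_component_def by blast
  define k where "k = linepath a s +++ c +++ linepath t b"
  have k: "path k" "pathstart k = a" "pathfinish k = b" unfolding k_def using c by auto
  have "path_image k \<subseteq> closed_segment a s \<union> path_image c \<union> closed_segment b t"
    unfolding k_def using c by (simp add: path_image_join closed_segment_commute) blast
  then have kK: "path_image k \<inter> K \<subseteq> {a, b}" using s t c by blast
  \<comment> \<open>The concatenation may cross itself; an arc is extracted from its image.\<close>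
  obtain h where h: "arc h" "path_image h \<subseteq> path_image k" "pathstart h = a" "pathfinish h = b"
    using path_contains_arc[OF k ab] by metis
  have "a \<in> path_image h" "b \<in> path_image h" using h by (metis pathstart_in_path_image, metis pathfinish_in_path_image)
  moreover have "a \<in> K" "b \<in> K" using s t by auto
  ultimately show ?thesis using that[of h] h kK by blast
qed

text \<open>Provides the angle of an edge at \<open>v\<close>; the half-open range makes it
  unique.\<close>

lemma circle_point_in_radial_edge:
  assumes "radial_at G p \<gamma> v r" "e \<in> edges G" "v \<in> e"
  obtains \<theta> where "- pi < \<theta>" "\<theta> \<le> pi" "path_image (\<gamma> e) \<inter> sphere (p v) r = {p v + rcis r \<theta>}"
proof -
  obtain q where q: "dist (p v) q = r" "path_image (\<gamma> e) \<inter> cball (p v) r = closed_segment (p v) q" and r: "0 < r"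
    using assms unfolding radial_at_def by blast
  have "closed_segment (p v) q \<inter> sphere (p v) r = {q}"
  proof -
    have "y = q" if y: "y \<in> closed_segment (p v) q" "y \<in> sphere (p v) r" for y
    proof -
      obtain t where t: "0 \<le> t" "t \<le> 1" "y = p v + t *\<^sub>R (q - p v)"
        by (rule closed_segment_point[OF y(1)])
      then have "dist (p v) y = t * r" using q(1) t(1) by (simp add: dist_norm norm_minus_commute)
      then have "t = 1" using y(2) r by simp
      then show ?thesis using t(3) by simp
    qed
    then show ?thesis using q by auto
  qed
  moreover have "sphere (p v) r \<subseteq> cball (p v) r" by auto
  ultimately have "path_image (\<gamma> e) \<inter> sphere (p v) r = {q}" using q(2) by blast
  moreover have "q = p v + rcis r (Arg (q - p v))"
    using q(1) rcis_cmod_Arg[of "q - p v"] by (simp add: dist_norm norm_minus_commute)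
  ultimately show ?thesis using that[of "Arg (q - p v)"] Arg_bounded[of "q - p v"] by simp
qed

text \<open>Two edges at \<open>x\<close> with no further edge between them in the angular order: their other ends
  lie on a common face.\<close>

lemma consecutive_edges_arc:
  assumes G: "simple_graph G" and dr: "plane_drawing G p \<gamma>"
    and rad: "\<And>v. v \<in> verts G \<Longrightarrow> radial_at G p \<gamma> v (R v)"
    and e: "{x, u} \<in> edges G" "{x, w} \<in> edges G" "u \<noteq> w"
    and \<alpha>\<beta>: "\<alpha> < \<beta>" and \<alpha>: "p x + rcis (R x) \<alpha> \<in> path_image (\<gamma> {x, u})"
    and \<beta>: "p x + rcis (R x) \<beta> \<in> path_image (\<gamma> {x, w})"
    and free: "\<And>t. \<alpha> < t \<Longrightarrow> t < \<beta> \<Longrightarrow> p x + rcis (R x) t \<notin> drawing_set G p \<gamma>"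
  obtains h where "arc h" "pathstart h = p u" "pathfinish h = p w" "path_image h \<inter> drawing_set G p \<gamma> = {p u, p w}"
proof -
  let ?K = "drawing_set G p \<gamma>"
  define f where "f t = p x + rcis (R x) t" for t
  have V: "x \<in> verts G" "u \<in> verts G" "w \<in> verts G" using e simple_graph_edge_subset[OF G] by auto
  have inj: "inj_on p (verts G)" using dr by (simp add: plane_drawing_def)
  have r: "0 < R x" using rad[OF V(1)] by (simp add: radial_at_def)
  have contf: "continuous_on S f" for S
    unfolding f_def rcis_def cis_conv_exp by (intro continuous_intros)
  have notV: "f t \<notin> p ` verts G" for t
  proof
    assume "f t \<in> p ` verts G"
    moreover have "f t \<in> cball (p x) (R x)" using r by (simp add: f_def dist_norm)
    ultimately have "f t = p x" using rad[OF V(1)] by (auto simp: radial_at_def)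
    then show False using r by (simp add: f_def)
  qed
  \<comment> \<open>The middle of the free circular arc represents the face between the two
    edges.\<close>
  define z where "z = f ((\<alpha> + \<beta>)/2)"
  have zK: "z \<notin> ?K" using free[of "(\<alpha>+\<beta>)/2"] \<alpha>\<beta> by (simp add: z_def f_def)
  \<comment> \<open>The circular arc over \<open>I\<close> leads from \<open>z\<close> to the edge
    \<open>{x, y}\<close> without meeting anything else, and the edge then leads away from
    \<open>x\<close> to \<open>y\<close>.\<close>
  have acc: "accessible ?K z (p y)"
    if y: "{x, y} \<in> edges G" and t0: "f t0 \<in> path_image (\<gamma> {x, y})"
      and I: "connected I" "t0 \<in> I" "(\<alpha> + \<beta>)/2 \<in> I" "\<And>t. t \<in> I \<Longrightarrow> t \<noteq> t0 \<Longrightarrow> f t \<notin> ?K" for y t0 I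
  proof (rule accessible_along_edge[OF G dr y])
    have yV: "y \<in> verts G" using simple_graph_edge_subset[OF G y] by auto
    show "radial_at G p \<gamma> y (R y)" by (rule rad[OF yV])
    show "z \<notin> path_image (\<gamma> {x, y})" using zK y by (auto simp: drawing_set_def)
    show "f t0 \<in> path_image (\<gamma> {x, y})" by fact
    show "f t0 \<notin> p ` {x, y}" using notV V yV by blast
    let ?K' = "p ` verts G \<union> (\<Union>e'\<in>edges G - {{x, y}}. path_image (\<gamma> e'))"
    have "f ` I \<subseteq> - ?K'"
    proof -
      have "f t \<notin> ?K'" if "t \<in> I" for t
      proof (cases "t = t0")
        case False
        show ?thesis using I(4)[OF that False] unfolding drawing_set_def by blast
      next
        case True
        have "f t0 \<notin> path_image (\<gamma> e')" if "e' \<in> edges G - {{x, y}}" for e'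
        proof
          assume "f t0 \<in> path_image (\<gamma> e')"
          moreover have "path_image (\<gamma> {x, y}) \<inter> path_image (\<gamma> e') \<subseteq> p ` ({x, y} \<inter> e')"
            using dr y that unfolding plane_drawing_def by (metis DiffD1 DiffD2 singletonI)
          ultimately have "f t0 \<in> p ` ({x, y} \<inter> e')" using t0 by blast
          then show False using notV V yV by blast
        qed
        then show ?thesis unfolding True using notV by blast
      qed
      then show ?thesis by auto
    qed
    moreover have "connected (f ` I)"
      using I(1) contf by (intro connected_continuous_image) auto
    moreover have "z \<in> f ` I" "f t0 \<in> f ` I" using I by (auto simp: z_def)
    ultimately show "connected_component (- ?K') z (f t0)" unfolding connected_component_def by blast
  qed simp
  \<comment> \<open>Each half-open interval contains the angle of the edge to be followed and omits
    that of the other edge.\<close>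
  have "accessible ?K z (p u)"
    by (rule acc[OF e(1), of \<alpha> "{\<alpha>..<\<beta>}"]) (use \<alpha> \<alpha>\<beta> free in \<open>auto simp: f_def connected_Ico field_simps\<close>)
  moreover have "accessible ?K z (p w)"
    by (rule acc[OF e(2), of \<beta> "{\<alpha><..\<beta>}"]) (use \<beta> \<alpha>\<beta> free in \<open>auto simp: f_def connected_Ioc field_simps\<close>)
  moreover have "p u \<noteq> p w" using inj V e(3) by (auto dest: inj_onD)
  moreover have "closed ?K" using compact_drawing_set[OF G dr] compact_imp_closed by blast
  ultimately show ?thesis using accessible_arc that by metis
qed

section \<open>Nonadjacent vertices on a common face\<close>

definition has_diamond :: "'a graph \<Rightarrow> bool" where
  "has_diamond G \<longleftrightarrow> (\<exists>a b c d. distinct [a, b, c, d] \<and>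
     {a, b} \<in> edges G \<and> {a, c} \<in> edges G \<and> {b, c} \<in> edges G \<and> {a, d} \<in> edges G \<and> {b, d} \<in> edges G)"

text \<open>The three smallest elements have this property; choosing them avoids the wrap-around of
  angles at \<open>pi\<close>.\<close>

lemma three_consecutive_reals:
  fixes T :: "real set"
  assumes "finite T" "3 \<le> card T"
  obtains t0 t1 t2 where "t0 \<in> T" "t1 \<in> T" "t2 \<in> T" "t0 < t1" "t1 < t2"
    "\<And>t. t \<in> T \<Longrightarrow> \<not> (t0 < t \<and> t < t1)" "\<And>t. t \<in> T \<Longrightarrow> \<not> (t1 < t \<and> t < t2)"
proof -
  define t0 where "t0 = Min T"
  define t1 where "t1 = Min (T - {t0})"
  define t2 where "t2 = Min (T - {t0} - {t1})"
  have t0: "t0 \<in> T" "\<And>t. t \<in> T \<Longrightarrow> t0 \<le> t" unfolding t0_def using assms by (auto intro: Min_in)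
  have c1: "card (T - {t0}) \<ge> 2" using assms t0 by simp
  then have "T - {t0} \<noteq> {}" by (metis card.empty not_numeral_le_zero)
  then have t1: "t1 \<in> T - {t0}" "\<And>t. t \<in> T - {t0} \<Longrightarrow> t1 \<le> t"
    unfolding t1_def using assms(1) Min_in[of "T - {t0}"] by auto
  have "card (T - {t0} - {t1}) \<ge> 1" using c1 t1(1) assms(1) by (subst card_Diff_singleton) auto
  then have "T - {t0} - {t1} \<noteq> {}" by (metis card.empty not_one_le_zero)
  then have t2: "t2 \<in> T - {t0} - {t1}" "\<And>t. t \<in> T - {t0} - {t1} \<Longrightarrow> t2 \<le> t"
    unfolding t2_def using assms(1) Min_in[of "T - {t0} - {t1}"] by auto
  have "t0 < t1" using t0(2)[of t1] t1(1) by (auto simp: less_le)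
  moreover have "t1 < t2" using t1(2)[of t2] t2(1) by (auto simp: less_le)
  moreover have "\<not> (t0 < t \<and> t < t1)" if "t \<in> T" for t using t1(2)[of t] that by auto
  moreover have "\<not> (t1 < t \<and> t < t2)" if "t \<in> T" for t
    using t2(2)[of t] that \<open>t0 < t1\<close> by auto
  ultimately show ?thesis using that[of t0 t1 t2] t0(1) t1(1) t2(1) by blast
qed

lemma rcis_inject:
  assumes "0 < r" "rcis r s = rcis r t" "- pi < s" "s \<le> pi" "- pi < t" "t \<le> pi"
  shows "s = t"
  using Arg_unique'[of r s "rcis r s"] Arg_unique'[of r t "rcis r s"] assms by auto

text \<open>The result speaks of a new drawing \<open>\<gamma>'\<close>, because angles of edges at
  \<open>x\<close> exist only after the drawing has been made radial; the positions \<open>p\<close>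
  of the vertices are kept.\<close>

lemma nonadjacent_on_common_face:
  assumes G: "simple_graph G" and dr: "plane_drawing G p \<gamma>" and nd: "\<not> has_diamond G"
    and deg: "3 \<le> vertex_degree G x"
  obtains \<gamma>' u w h where "plane_drawing G p \<gamma>'" "u \<in> verts G" "w \<in> verts G" "u \<noteq> w" "{u, w} \<notin> edges G"
    "arc h" "pathstart h = p u" "pathfinish h = p w" "path_image h \<inter> drawing_set G p \<gamma>' = {p u, p w}"
proof -
  obtain \<gamma>' R where dr': "plane_drawing G p \<gamma>'" and rad: "\<And>v. v \<in> verts G \<Longrightarrow> radial_at G p \<gamma>' v (R v)"
    using radial_drawing_exists[OF G dr] by metis
  define F where "F = {e \<in> edges G. x \<in> e}"
  have F: "finite F" "3 \<le> card F"
    using simple_graph_finite_edges[OF G] deg by (auto simp: F_def vertex_degree_def)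
  have "F \<noteq> {}" using F(2) by (metis card.empty not_numeral_le_zero)
  then obtain e0 where "e0 \<in> edges G" "x \<in> e0" by (auto simp: F_def)
  then have x: "x \<in> verts G" using simple_graph_edge_subset[OF G] by auto
  let ?S = "sphere (p x) (R x)"
  have r: "0 < R x" using rad[OF x] by (simp add: radial_at_def)
  have "\<exists>\<theta>. - pi < \<theta> \<and> \<theta> \<le> pi \<and> path_image (\<gamma>' e) \<inter> ?S = {p x + rcis (R x) \<theta>}" if "e \<in> F" for e
  proof -
    have "e \<in> edges G" "x \<in> e" using that by (auto simp: F_def)
    then show ?thesis using circle_point_in_radial_edge[OF rad[OF x]] by metis
  qed
  then obtain \<theta> where \<theta>: "\<And>e. e \<in> F \<Longrightarrow> - pi < \<theta> e \<and> \<theta> e \<le> pi"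
    "\<And>e. e \<in> F \<Longrightarrow> path_image (\<gamma>' e) \<inter> ?S = {p x + rcis (R x) (\<theta> e)}"
    by metis
  have \<theta>im: "p x + rcis (R x) (\<theta> e) \<in> path_image (\<gamma>' e)" if "e \<in> F" for e
    using \<theta>(2)[OF that] by (metis Int_iff insertI1)
  have onS: "p x + rcis (R x) t \<in> ?S" for t using r by (simp add: dist_norm)
  have "inj_on \<theta> F"
  proof (rule inj_onI, rule ccontr)
    fix e e' assume e: "e \<in> F" "e' \<in> F" "\<theta> e = \<theta> e'" "e \<noteq> e'"
    have ee: "e \<in> edges G" "e' \<in> edges G" "x \<in> e" "x \<in> e'" using e by (auto simp: F_def)
    have "path_image (\<gamma>' e) \<inter> path_image (\<gamma>' e') \<subseteq> p ` (e \<inter> e')"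
      using dr' ee e(4) unfolding plane_drawing_def by metis
    then have "p x + rcis (R x) (\<theta> e) \<in> p ` (e \<inter> e')" using \<theta>im[OF e(1)] \<theta>im[OF e(2)] e(3) by auto
    then have "p x + rcis (R x) (\<theta> e) = p x" using edges_meet_in_vertex[OF G ee(1,2) e(4) ee(3,4)] by simp
    then show False using r by simp
  qed
  then have "3 \<le> card (\<theta> ` F)" using F by (simp add: card_image)
  then obtain t0 t1 t2 where t: "t0 \<in> \<theta> ` F" "t1 \<in> \<theta> ` F" "t2 \<in> \<theta> ` F" "t0 < t1" "t1 < t2"
    and c1: "\<And>t. t \<in> \<theta> ` F \<Longrightarrow> \<not> (t0 < t \<and> t < t1)" and c2: "\<And>t. t \<in> \<theta> ` F \<Longrightarrow> \<not> (t1 < t \<and> t < t2)"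
    using three_consecutive_reals[of "\<theta> ` F"] F(1) by (metis finite_imageI)
  \<comment> \<open>The circle around \<open>x\<close> meets the drawing only at the angles of the
    edges at \<open>x\<close>, so consecutive angles bound a free sector.\<close>
  have free: "t \<in> \<theta> ` F" if t: "p x + rcis (R x) t \<in> drawing_set G p \<gamma>'" "- pi < t" "t \<le> pi" for t
  proof -
    let ?y = "p x + rcis (R x) t"
    have ycb: "?y \<in> cball (p x) (R x)" using r by (simp add: dist_norm)
    have "?y \<noteq> p x" using r by simp
    then have "?y \<notin> p ` verts G" using rad[OF x] ycb unfolding radial_at_def by (metis IntI singletonD)
    then obtain e where e: "e \<in> edges G" "?y \<in> path_image (\<gamma>' e)"
      using t(1) unfolding drawing_set_def by blast
    have "x \<in> e" using rad[OF x] e ycb unfolding radial_at_def by (metis IntI empty_iff)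
    then have "e \<in> F" using e by (simp add: F_def)
    then have "rcis (R x) t = rcis (R x) (\<theta> e)" using \<theta>(2) e(2) onS[of t] by (metis IntI add_left_cancel singletonD)
    then have "t = \<theta> e" using rcis_inject[OF r] t(2,3) \<theta>(1)[OF \<open>e \<in> F\<close>] by metis
    then show ?thesis using \<open>e \<in> F\<close> by simp
  qed
  have range: "- pi < t0" "t2 \<le> pi" using t(1,3) \<theta>(1) by auto
  have nbr: "\<exists>u. {x, u} \<in> F \<and> s = \<theta> {x, u}" if s: "s \<in> \<theta> ` F" for s
  proof -
    obtain e where e: "e \<in> F" "s = \<theta> e" using s by auto
    then obtain u where "e = {x, u}" using simple_graph_edge_other[OF G, of e x] by (auto simp: F_def)
    then show ?thesis using e by auto
  qed
  obtain u0 where u0: "{x, u0} \<in> F" "t0 = \<theta> {x, u0}" using nbr[OF t(1)] by auto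
  obtain u1 where u1: "{x, u1} \<in> F" "t1 = \<theta> {x, u1}" using nbr[OF t(2)] by auto
  obtain u2 where u2: "{x, u2} \<in> F" "t2 = \<theta> {x, u2}" using nbr[OF t(3)] by auto
  have E: "{x, u0} \<in> edges G" "{x, u1} \<in> edges G" "{x, u2} \<in> edges G" using u0 u1 u2 by (auto simp: F_def)
  have uV: "u0 \<in> verts G" "u1 \<in> verts G" "u2 \<in> verts G" using E simple_graph_edge_subset[OF G] by auto
  have card2: "card e = 2" if "e \<in> edges G" for e using G that by (simp add: simple_graph_def)
  have ne: "u0 \<noteq> u1" "u1 \<noteq> u2" "u0 \<noteq> u2" using t(4,5) u0 u1 u2 by auto
  have nx: "x \<noteq> u0" "x \<noteq> u1" "x \<noteq> u2" using card2[OF E(1)] card2[OF E(2)] card2[OF E(3)] by auto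
  obtain h1 where h1: "arc h1" "pathstart h1 = p u0" "pathfinish h1 = p u1" "path_image h1 \<inter> drawing_set G p \<gamma>' = {p u0, p u1}"
  proof (rule consecutive_edges_arc[OF G dr' rad E(1,2) ne(1) t(4)])
    show "p x + rcis (R x) t0 \<in> path_image (\<gamma>' {x, u0})" using \<theta>im[OF u0(1)] u0(2) by simp
    show "p x + rcis (R x) t1 \<in> path_image (\<gamma>' {x, u1})" using \<theta>im[OF u1(1)] u1(2) by simp
    show "p x + rcis (R x) t \<notin> drawing_set G p \<gamma>'" if "t0 < t" "t < t1" for t
      using free[of t] c1[of t] that range t(4,5) by auto
  qed auto
  obtain h2 where h2: "arc h2" "pathstart h2 = p u1" "pathfinish h2 = p u2" "path_image h2 \<inter> drawing_set G p \<gamma>' = {p u1, p u2}"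
  proof (rule consecutive_edges_arc[OF G dr' rad E(2,3) ne(2) t(5)])
    show "p x + rcis (R x) t1 \<in> path_image (\<gamma>' {x, u1})" using \<theta>im[OF u1(1)] u1(2) by simp
    show "p x + rcis (R x) t2 \<in> path_image (\<gamma>' {x, u2})" using \<theta>im[OF u2(1)] u2(2) by simp
    show "p x + rcis (R x) t \<notin> drawing_set G p \<gamma>'" if "t1 < t" "t < t2" for t
      using free[of t] c2[of t] that range t(4,5) by auto
  qed auto
  show ?thesis
  proof (cases "{u0, u1} \<in> edges G")
    case False
    show ?thesis by (rule that[OF dr' uV(1,2) ne(1) False h1])
  next
    case True
    have "{u1, u2} \<notin> edges G"
    proof
      assume "{u1, u2} \<in> edges G"
      then have "has_diamond G" unfolding has_diamond_def using True E ne nx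
        by (intro exI[of _ x] exI[of _ u1] exI[of _ u0] exI[of _ u2]) (auto simp: insert_commute)
      then show False using nd by simp
    qed
    then show ?thesis by (intro that[OF dr' uV(2,3) ne(2) _ h2])
  qed
qed

section \<open>Inserting a vertex of degree two\<close>

text \<open>The arc is subdivided: the new vertex sits at \<open>h (1/2)\<close> and the two halves
  are its edges. Injectivity of \<open>h\<close> separates the halves from each other, and the
  hypothesis on \<open>path_image h\<close> separates them from the old drawing.\<close>

lemma planar_add_degree_two_vertex:
  assumes G: "simple_graph G" and dr: "plane_drawing G p \<gamma>"
    and uw: "u \<in> verts G" "w \<in> verts G" "u \<noteq> w" and z: "z \<notin> verts G"
    and h: "arc h" "pathstart h = p u" "pathfinish h = p w" "path_image h \<inter> drawing_set G p \<gamma> = {p u, p w}"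
  shows "planar_graph (insert z (verts G), insert {u, z} (insert {w, z} (edges G)))"
proof -
  define A where "A = subpath 0 (1/2) h"
  define B where "B = subpath (1/2) 1 h"
  define p' where "p' = p(z := h (1/2))"
  define \<gamma>' where "\<gamma>' e = (if e = {u, z} then A else if e = {w, z} then B else \<gamma> e)" for e
  let ?G = "(insert z (verts G), insert {u, z} (insert {w, z} (edges G)))"
  let ?K = "drawing_set G p \<gamma>"
  have inj: "inj_on h {0..1}" using h(1) by (simp add: arc_def)
  have injD: "s = t" if "h s = h t" "0 \<le> s" "s \<le> 1" "0 \<le> t" "t \<le> 1" for s t
    using inj that by (auto dest: inj_onD)
  have h01: "h 0 = p u" "h 1 = p w" using h by (simp_all add: pathstart_def pathfinish_def)
  have A: "arc A" "pathstart A = p u" "pathfinish A = h (1/2)" "path_image A = h ` {0..1/2}"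
    and B: "arc B" "pathstart B = h (1/2)" "pathfinish B = p w" "path_image B = h ` {1/2..1}"
    using h(1) h01 by (auto simp: A_def B_def path_image_subpath intro: arc_subpath_arc)
  have Ah: "path_image A \<subseteq> path_image h" and Bh: "path_image B \<subseteq> path_image h"
    unfolding A(4) B(4) unfolding path_image_def by (auto intro!: image_mono)
  have wA: "p w \<notin> path_image A"
  proof
    assume "p w \<in> path_image A"
    then obtain t where "t \<in> {0..1/2}" "h 1 = h t" unfolding A(4) h01(2)[symmetric] by blast
    then show False using injD[of 1 t] by simp
  qed
  have uB: "p u \<notin> path_image B"
  proof
    assume "p u \<in> path_image B"
    then obtain t where "t \<in> {1/2..1}" "h 0 = h t" unfolding B(4) h01(1)[symmetric] by blast
    then show False using injD[of 0 t] by simp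
  qed
  have hends: "y = p u \<or> y = p w" if "y \<in> path_image h" "y \<in> ?K" for y
    using h(4) that by (metis IntI insertE singletonD)
  have uwK: "p u \<in> ?K" "p w \<in> ?K" using uw by (auto simp: drawing_set_def)
  have mem: "p u \<in> path_image A" "h (1/2) \<in> path_image A" "h (1/2) \<in> path_image B" "p w \<in> path_image B"
    using pathstart_in_path_image[of A] pathfinish_in_path_image[of A]
      pathstart_in_path_image[of B] pathfinish_in_path_image[of B] unfolding A(2,3) B(2,3) .
  have AK: "path_image A \<inter> ?K = {p u}"
  proof (intro equalityI subsetI)
    fix y assume "y \<in> path_image A \<inter> ?K"
    then show "y \<in> {p u}" using hends[of y] wA Ah by (metis IntE insertI1 subsetD)
  qed (use mem uwK in simp)
  have BK: "path_image B \<inter> ?K = {p w}"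
  proof (intro equalityI subsetI)
    fix y assume "y \<in> path_image B \<inter> ?K"
    then show "y \<in> {p w}" using hends[of y] uB Bh by (metis IntE insertI1 subsetD)
  qed (use mem uwK in simp)
  have AB: "path_image A \<inter> path_image B \<subseteq> {h (1/2)}"
  proof
    fix y assume "y \<in> path_image A \<inter> path_image B"
    then obtain s t where st: "y = h s" "s \<in> {0..1/2}" "y = h t" "t \<in> {1/2..1}"
      unfolding A(4) B(4) by (elim IntE imageE)
    then have "s = t" using injD[of s t] by simp
    then have "s = 1/2" using st(2,4) by simp
    then show "y \<in> {h (1/2)}" using st(1) by (simp only: singleton_iff)
  qed
  have hK: "h (1/2) \<notin> ?K"
  proof
    assume "h (1/2) \<in> ?K"
    then have "h (1/2) \<in> {p u}" using mem(2) unfolding AK[symmetric] by (rule IntI[rotated])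
    then show False using injD[of "1/2" 0] h01 by simp
  qed
  have VK: "p ` verts G \<subseteq> ?K" by (simp add: drawing_set_def)
  have eK: "path_image (\<gamma> e) \<subseteq> ?K" if "e \<in> edges G" for e using that unfolding drawing_set_def by blast
  have injp: "inj_on p (verts G)" using dr by (simp add: plane_drawing_def)
  have p'V: "p' v = p v" if "v \<in> verts G" for v using that z by (auto simp: p'_def)
  have p'z: "p' z = h (1/2)" by (simp add: p'_def)
  have p'im: "p' ` S = p ` S" if "S \<subseteq> verts G" for S
    using that p'V by (intro image_cong) auto
  have im: "p' ` verts ?G = insert (h (1/2)) (p ` verts G)" using p'im[of "verts G"] p'z by simp
  have old: "e \<noteq> {u, z}" "e \<noteq> {w, z}" "e \<subseteq> verts G" if "e \<in> edges G" for e
    using simple_graph_edge_subset[OF G that] z by auto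
  have nz: "u \<noteq> z" "w \<noteq> z" using uw z by auto
  have ne: "{u, z} \<noteq> {w, z}" using uw(3) nz by (auto simp: doubleton_eq_iff)
  have \<gamma>'s: "\<gamma>' {u, z} = A" "\<gamma>' {w, z} = B" using ne by (simp_all add: \<gamma>'_def)
  have \<gamma>'old: "\<gamma>' e = \<gamma> e" if "e \<in> edges G" for e using old[OF that] by (simp add: \<gamma>'_def)
  have inj': "inj_on p' (verts ?G)"
  proof -
    have "inj_on p' (verts G)" using injp p'V by (metis inj_on_cong)
    moreover have "p' z \<notin> p' ` verts G" using hK VK p'im[of "verts G"] p'z by auto
    ultimately show ?thesis using z by simp
  qed
  have P1: "arc (\<gamma>' e) \<and> {pathstart (\<gamma>' e), pathfinish (\<gamma>' e)} = p' ` e \<and> path_image (\<gamma>' e) \<inter> p' ` verts ?G = p' ` e"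
    if "e \<in> edges ?G" for e
  proof -
    consider "e = {u, z}" | "e = {w, z}" | "e \<in> edges G" using \<open>e \<in> edges ?G\<close> by auto
    then show ?thesis
    proof cases
      case 1
      have pe: "p' ` e = {p u, h (1/2)}" using 1 p'V[OF uw(1)] p'z by simp
      moreover have "path_image A \<inter> insert (h (1/2)) (p ` verts G) = {p u, h (1/2)}"
      proof
        show "path_image A \<inter> insert (h (1/2)) (p ` verts G) \<subseteq> {p u, h (1/2)}"
          using Int_mono[OF subset_refl VK, of "path_image A"] unfolding AK by auto
        show "{p u, h (1/2)} \<subseteq> path_image A \<inter> insert (h (1/2)) (p ` verts G)" using mem uw(1) by simp
      qed
      ultimately show ?thesis unfolding im unfolding 1 \<gamma>'s A(2,3) using A(1) by simp
    next
      case 2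
      have pe: "p' ` e = {p w, h (1/2)}" using 2 p'V[OF uw(2)] p'z by simp
      moreover have "path_image B \<inter> insert (h (1/2)) (p ` verts G) = {p w, h (1/2)}"
      proof
        show "path_image B \<inter> insert (h (1/2)) (p ` verts G) \<subseteq> {p w, h (1/2)}"
          using Int_mono[OF subset_refl VK, of "path_image B"] unfolding BK by auto
        show "{p w, h (1/2)} \<subseteq> path_image B \<inter> insert (h (1/2)) (p ` verts G)" using mem uw(2) by simp
      qed
      ultimately show ?thesis unfolding im unfolding 2 \<gamma>'s B(2,3) using B(1) by (simp add: insert_commute)
    next
      case 3
      have "arc (\<gamma> e)" "{pathstart (\<gamma> e), pathfinish (\<gamma> e)} = p ` e" "path_image (\<gamma> e) \<inter> p ` verts G = p ` e"
        using dr 3 by (auto simp: plane_drawing_def)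
      moreover have "h (1/2) \<notin> path_image (\<gamma> e)" using hK eK[OF 3] by blast
      ultimately show ?thesis unfolding im \<gamma>'old[OF 3] p'im[OF old(3)[OF 3]] by simp
    qed
  qed
  have new_old: "path_image C \<inter> path_image (\<gamma> e) \<subseteq> p' ` ({c, z} \<inter> e)"
    if C: "path_image C \<inter> ?K = {p c}" and c: "c \<in> verts G" and e: "e \<in> edges G" for C c e
  proof
    fix y assume y: "y \<in> path_image C \<inter> path_image (\<gamma> e)"
    then have "y \<in> path_image C \<inter> ?K" using eK[OF e] by (metis IntE IntI subsetD)
    then have "y = p c" unfolding C by simp
    moreover have "path_image (\<gamma> e) \<inter> p ` verts G = p ` e" using dr e by (simp add: plane_drawing_def)
    ultimately have "p c \<in> p ` e" using y c by (metis IntE IntI imageI)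
    then have "c \<in> e" using injp c old(3)[OF e] by (auto dest: inj_onD)
    then show "y \<in> p' ` ({c, z} \<inter> e)" using \<open>y = p c\<close> p'V[OF c] by force
  qed
  have AB': "path_image A \<inter> path_image B \<subseteq> p' ` ({u, z} \<inter> {w, z})"
  proof -
    have "{h (1/2)} \<subseteq> p' ` ({u, z} \<inter> {w, z})" unfolding p'z[symmetric] by simp
    then show ?thesis using AB by (rule subset_trans[rotated])
  qed
  have P2: "path_image (\<gamma>' e) \<inter> path_image (\<gamma>' e') \<subseteq> p' ` (e \<inter> e')"
    if e: "e \<in> edges ?G" "e' \<in> edges ?G" "e \<noteq> e'" for e e'
  proof -
    have mixed: "path_image (\<gamma>' f) \<inter> path_image (\<gamma>' e) \<subseteq> p' ` (f \<inter> e)" if "f \<in> {{u, z}, {w, z}}" "e \<in> edges G" for f e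
      using new_old[OF AK uw(1) that(2)] new_old[OF BK uw(2) that(2)] \<gamma>'s \<gamma>'old[OF that(2)] that(1) by auto
    consider "e \<in> edges G" "e' \<in> edges G" | "e \<in> edges G" "e' \<in> {{u, z}, {w, z}}"
      | "e \<in> {{u, z}, {w, z}}" "e' \<in> edges G" | "e = {u, z}" "e' = {w, z}" | "e = {w, z}" "e' = {u, z}"
      using e by auto
    then show ?thesis
    proof cases
      case 1
      have "path_image (\<gamma> e) \<inter> path_image (\<gamma> e') \<subseteq> p ` (e \<inter> e')"
        using dr 1 e(3) unfolding plane_drawing_def by metis
      moreover have "p' ` (e \<inter> e') = p ` (e \<inter> e')" using old(3)[OF 1(1)] by (intro p'im) auto
      ultimately show ?thesis unfolding \<gamma>'old[OF 1(1)] \<gamma>'old[OF 1(2)] by simp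
    next
      case 2 then show ?thesis using mixed[of e' e] by (simp add: Int_commute)
    next
      case 3 then show ?thesis using mixed[of e e'] by simp
    next
      case 4 show ?thesis unfolding 4 \<gamma>'s by (rule AB')
    next
      case 5 show ?thesis unfolding 5 \<gamma>'s using AB' by (simp only: Int_commute)
    qed
  qed
  have "plane_drawing ?G p' \<gamma>'"
    unfolding plane_drawing_def using inj' P1 P2 by blast
  then show ?thesis unfolding planar_graph_def by blast
qed

section \<open>Straight-line drawings of two small graphs\<close>

text \<open>Twice the signed area of the triangle \<open>a b c\<close>.\<close>

definition orient :: "complex \<Rightarrow> complex \<Rightarrow> complex \<Rightarrow> real" where
  "orient a b c = (Re b - Re a) * (Im c - Im a) - (Im b - Im a) * (Re c - Re a)"

text \<open>\<open>orient\<close> is affine in its third argument.\<close>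

lemma orient_segment:
  assumes "x \<in> closed_segment c d"
  obtains t where "0 \<le> t" "t \<le> 1" "x = c + t *\<^sub>R (d - c)"
    "\<And>a b. orient a b x = (1 - t) * orient a b c + t * orient a b d"
proof -
  obtain t where t: "0 \<le> t" "t \<le> 1" "x = c + t *\<^sub>R (d - c)"
    by (rule closed_segment_point[OF assms])
  moreover have "orient a b x = (1 - t) * orient a b c + t * orient a b d" for a b
    unfolding t(3) orient_def by (simp add: algebra_simps)
  ultimately show ?thesis using that by blast
qed

lemma orient_on_segment: "x \<in> closed_segment a b \<Longrightarrow> orient a b x = 0"
  by (elim orient_segment) (simp add: orient_def)

text \<open>Equal signs put \<open>c\<close> and \<open>d\<close> strictly on the same side of the
  line through \<open>a\<close> and \<open>b\<close>, so the second segment misses that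
  line.\<close>

lemma segments_disjoint:
  assumes "0 < orient a b c * orient a b d"
  shows "closed_segment a b \<inter> closed_segment c d = {}"
proof -
  have False if x: "x \<in> closed_segment a b" "x \<in> closed_segment c d" for x
  proof -
    obtain t where t: "0 \<le> t" "t \<le> 1" "orient a b x = (1 - t) * orient a b c + t * orient a b d"
      using orient_segment[OF x(2)] by metis
    have "(1 - t) * orient a b c + t * orient a b d = 0" using t(3) orient_on_segment[OF x(1)] by simp
    moreover have "0 < orient a b c \<and> 0 < orient a b d \<or> orient a b c < 0 \<and> orient a b d < 0"
      using assms by (simp add: zero_less_mult_iff)
    ultimately show False
      using t(1,2) convex_bound_lt[of "orient a b c" 0 "orient a b d" "1-t" t]
        convex_bound_lt[of "- orient a b c" 0 "- orient a b d" "1-t" t] by auto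
  qed
  then show ?thesis by blast
qed

text \<open>A common point has orientation 0 relative to \<open>a\<close> and \<open>b\<close>,
  whereas along the segment from \<open>a\<close> to \<open>c\<close> the orientation grows linearly
  from 0 with nonzero slope.\<close>

lemma segments_common_end:
  assumes "orient a b c \<noteq> 0"
  shows "closed_segment a b \<inter> closed_segment a c \<subseteq> {a}"
proof
  fix x assume x: "x \<in> closed_segment a b \<inter> closed_segment a c"
  then obtain t where t: "x = a + t *\<^sub>R (c - a)" "orient a b x = (1 - t) * orient a b a + t * orient a b c"
    using orient_segment[of x a c] by (metis IntE)
  have "orient a b x = 0" using x orient_on_segment by blast
  then have "t = 0" using t(2) assms by (simp add: orient_def)
  then show "x \<in> {a}" using t(1) by simp
qed

text \<open>Reduces planarity to finitely many sign checks. General position keeps vertices off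
  other edges and handles edges with a common end; of two disjoint edges, one has to lie on one side
  of the line through the other.\<close>

lemma planar_straight_line:
  fixes p :: "nat \<Rightarrow> complex" and es :: "(nat \<times> nat) set"
  assumes n: "3 \<le> n"
    and gp: "\<And>i j k. i < n \<Longrightarrow> j < n \<Longrightarrow> k < n \<Longrightarrow> i \<noteq> j \<Longrightarrow> i \<noteq> k \<Longrightarrow> j \<noteq> k \<Longrightarrow> orient (p i) (p j) (p k) \<noteq> 0"
    and es: "\<And>i j. (i, j) \<in> es \<Longrightarrow> i < j \<and> j < n"
    and cross: "\<And>i j k l. (i, j) \<in> es \<Longrightarrow> (k, l) \<in> es \<Longrightarrow> {i, j} \<inter> {k, l} = {} \<Longrightarrow>
       0 < orient (p i) (p j) (p k) * orient (p i) (p j) (p l) \<or>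
       0 < orient (p k) (p l) (p i) * orient (p k) (p l) (p j)"
  shows "planar_graph ({..<n}, (\<lambda>(i, j). {i, j}) ` es)"
proof -
  let ?G = "({..<n}, (\<lambda>(i, j). {i, j}) ` es)"
  \<comment> \<open>An edge is an unordered pair; \<open>Min\<close> and \<open>Max\<close> fix its
    direction, in accordance with \<open>i < j\<close> in \<open>es\<close>.\<close>
  define \<gamma> where "\<gamma> e = linepath (p (Min e)) (p (Max e))" for e
  have \<gamma>: "\<gamma> {i, j} = linepath (p i) (p j)" if "(i, j) \<in> es" for i j
    using es[OF that] by (simp add: \<gamma>_def min_def max_def)
  have inj: "p i \<noteq> p j" if ij: "i < n" "j < n" "i \<noteq> j" for i j
  proof -
    \<comment> \<open>Points are distinct because a third index exists and the orientation of a
      triple with a repeated point would vanish.\<close>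
    have "card {i, j} < card {..<n}" using n card_insert_le_m1[of 2 "{j}" i] by simp
    then have "\<not> {..<n} \<subseteq> {i, j}" by (meson card_mono finite.emptyI finite_insert not_le)
    then obtain k where "k < n" "k \<noteq> i" "k \<noteq> j" by auto
    then have "orient (p i) (p j) (p k) \<noteq> 0" using gp ij by auto
    then show ?thesis by (auto simp: orient_def)
  qed
  have off: "p k \<notin> closed_segment (p i) (p j)" if "i < n" "j < n" "k < n" "i \<noteq> j" "i \<noteq> k" "j \<noteq> k" for i j k
    using gp[OF that] orient_on_segment by blast
  have P1: "arc (\<gamma> e) \<and> {pathstart (\<gamma> e), pathfinish (\<gamma> e)} = p ` e \<and> path_image (\<gamma> e) \<inter> p ` verts ?G = p ` e"
    if eE: "e \<in> edges ?G" for e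
  proof -
    obtain i j where e: "e = {i, j}" "(i, j) \<in> es" using eE by auto
    have ij: "i < n" "j < n" "i \<noteq> j" using es[OF e(2)] by auto
    have "closed_segment (p i) (p j) \<inter> p ` {..<n} = {p i, p j}"
      using off[OF ij(1,2) _ ij(3)] ij by auto
    then show ?thesis using inj[OF ij] unfolding e(1) \<gamma>[OF e(2)] by simp
  qed
  have P2: "path_image (\<gamma> e) \<inter> path_image (\<gamma> e') \<subseteq> p ` (e \<inter> e')"
    if ee: "e \<in> edges ?G" "e' \<in> edges ?G" "e \<noteq> e'" for e e'
  proof -
    obtain i j where e: "e = {i, j}" "(i, j) \<in> es" using ee by auto
    obtain k l where e': "e' = {k, l}" "(k, l) \<in> es" using ee by auto
    have ij: "i < n" "j < n" "i \<noteq> j" and kl: "k < n" "l < n" "k \<noteq> l" using es[OF e(2)] es[OF e'(2)] by auto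
    have im: "path_image (\<gamma> e) = closed_segment (p i) (p j)" "path_image (\<gamma> e') = closed_segment (p k) (p l)"
      unfolding e(1) e'(1) \<gamma>[OF e(2)] \<gamma>[OF e'(2)] by simp_all
    show ?thesis
    proof (cases "e \<inter> e' = {}")
      case True
      then have "{i, j} \<inter> {k, l} = {}" unfolding e e' .
      from cross[OF e(2) e'(2) this]
      have "closed_segment (p i) (p j) \<inter> closed_segment (p k) (p l) = {}"
        using segments_disjoint[of "p i" "p j" "p k" "p l"] segments_disjoint[of "p k" "p l" "p i" "p j"] by blast
      then show ?thesis unfolding im by simp
    next
      case False
      have common: "closed_segment (p a) (p b) \<inter> closed_segment (p a) (p c) \<subseteq> p ` ({a, b} \<inter> {a, c})"
        if "a < n" "b < n" "c < n" "a \<noteq> b" "a \<noteq> c" "b \<noteq> c" for a b c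
      proof -
        have "{p a} \<subseteq> p ` ({a, b} \<inter> {a, c})" by simp
        then show ?thesis using segments_common_end[OF gp[OF that]] by (rule subset_trans[rotated])
      qed
      consider "i = k" "j \<noteq> l" | "i = l" "j \<noteq> k" | "j = k" "i \<noteq> l" | "j = l" "i \<noteq> k"
        using False ee(3) unfolding e e' by (auto simp: doubleton_eq_iff)
      then show ?thesis
      proof cases
        case 1 then show ?thesis unfolding im unfolding e e' using common[of i j l] ij kl by simp
      next
        case 2 then show ?thesis unfolding im unfolding e e'
          using common[of i j k] ij kl by (simp add: insert_commute closed_segment_commute)
      next
        case 3 then show ?thesis unfolding im unfolding e e'
          using common[of j i l] ij kl by (simp add: insert_commute closed_segment_commute)
      next
        case 4 then show ?thesis unfolding im unfolding e e'
          using common[of j i k] ij kl by (simp add: insert_commute closed_segment_commute)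
      qed
    qed
  qed
  have "inj_on p {..<n}" using inj by (meson inj_onI lessThan_iff)
  then have "plane_drawing ?G p \<gamma>" unfolding plane_drawing_def using P1 P2 by simp
  then show ?thesis unfolding planar_graph_def by blast
qed

text \<open>Two triangles on 0, 1, 2 and 3, 4, 5, joined by the matching of \<open>i\<close> with
  \<open>i + 3\<close>.\<close>

definition prism :: "nat graph" where
  "prism = ({..<6}, {{0, 1}, {0, 2}, {1, 2}, {3, 4}, {3, 5}, {4, 5}, {0, 3}, {1, 4}, {2, 5}})"

text \<open>Three triangles on the common edge \<open>{0, 1}\<close>, that is, the complete
  tripartite graph with parts of sizes 1, 1 and 3.\<close>

definition book3 :: "nat graph" where
  "book3 = ({..<5}, {{0, 1}, {0, 2}, {1, 2}, {0, 3}, {1, 3}, {0, 4}, {1, 4}})"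

lemma planar_prism: "planar_graph prism"
proof -
  \<comment> \<open>A small triangle nested in a large one, with coordinates perturbed so that no
    three of the six points are collinear.\<close>
  define q :: "nat \<Rightarrow> real \<times> real" where
    "q i = [(0, 20), (-20, -12), (21, -13), (1, 5), (-5, -4), (6, -3)] ! i" for i
  define p where "p i = Complex (fst (q i)) (snd (q i))" for i
  have six: "i < 6 \<longleftrightarrow> i = 0 \<or> i = 1 \<or> i = 2 \<or> i = 3 \<or> i = 4 \<or> i = 5" for i :: nat by auto
  have p: "p 0 = Complex 0 20" "p 1 = Complex (-20) (-12)" "p (Suc 0) = Complex (-20) (-12)" "p 2 = Complex 21 (-13)" "p 3 = Complex 1 5"
    "p 4 = Complex (-5) (-4)" "p 5 = Complex 6 (-3)"
    by (simp_all add: p_def q_def)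
  have "planar_graph ({..<6::nat}, (\<lambda>(i, j). {i, j}) ` {(0, 1), (0, 2), (1, 2), (3, 4), (3, 5), (4, 5), (0, 3), (1, 4), (2, 5)})"
  proof (rule planar_straight_line)
    show "orient (p i) (p j) (p k) \<noteq> 0"
      if "i < 6" "j < 6" "k < 6" "i \<noteq> j" "i \<noteq> k" "j \<noteq> k" for i j k
      using that unfolding six by (elim disjE) (simp_all add: p orient_def)
  next
    fix i j k l :: nat
    assume "(i, j) \<in> {(0, 1), (0, 2), (1, 2), (3, 4), (3, 5), (4, 5), (0, 3), (1, 4), (2, 5)}"
      "(k, l) \<in> {(0, 1), (0, 2), (1, 2), (3, 4), (3, 5), (4, 5), (0, 3), (1, 4), (2, 5)}" "{i, j} \<inter> {k, l} = {}"
    then show "0 < orient (p i) (p j) (p k) * orient (p i) (p j) (p l) \<or>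
       0 < orient (p k) (p l) (p i) * orient (p k) (p l) (p j)"
      by (simp only: insert_iff empty_iff prod.inject simp_thms) (elim disjE conjE; simp add: p orient_def)
  qed auto
  then show ?thesis by (simp add: prism_def)
qed

lemma planar_book3: "planar_graph book3"
proof -
  \<comment> \<open>Nested triangles over the common base from point 0 to point 1, again without
    collinear triples.\<close>
  define q :: "nat \<Rightarrow> real \<times> real" where
    "q i = [(0, 0), (10, 0), (4, 1), (5, 3), (6, 7)] ! i" for i
  define p where "p i = Complex (fst (q i)) (snd (q i))" for i
  have five: "i < 5 \<longleftrightarrow> i = 0 \<or> i = 1 \<or> i = 2 \<or> i = 3 \<or> i = 4" for i :: nat by auto
  have p: "p 0 = Complex 0 0" "p 1 = Complex 10 0" "p (Suc 0) = Complex 10 0" "p 2 = Complex 4 1" "p 3 = Complex 5 3" "p 4 = Complex 6 7"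
    by (simp_all add: p_def q_def)
  have "planar_graph ({..<5::nat}, (\<lambda>(i, j). {i, j}) ` {(0, 1), (0, 2), (1, 2), (0, 3), (1, 3), (0, 4), (1, 4)})"
  proof (rule planar_straight_line)
    show "orient (p i) (p j) (p k) \<noteq> 0"
      if "i < 5" "j < 5" "k < 5" "i \<noteq> j" "i \<noteq> k" "j \<noteq> k" for i j k
      using that unfolding five by (elim disjE) (simp_all add: p orient_def)
  next
    fix i j k l :: nat
    assume "(i, j) \<in> {(0, 1), (0, 2), (1, 2), (0, 3), (1, 3), (0, 4), (1, 4)}"
      "(k, l) \<in> {(0, 1), (0, 2), (1, 2), (0, 3), (1, 3), (0, 4), (1, 4)}" "{i, j} \<inter> {k, l} = {}"
    then show "0 < orient (p i) (p j) (p k) * orient (p i) (p j) (p l) \<or>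
       0 < orient (p k) (p l) (p i) * orient (p k) (p l) (p j)"
      by (simp only: insert_iff empty_iff prod.inject simp_thms) (elim disjE conjE; simp add: p orient_def)
  qed auto
  then show ?thesis by (simp add: book3_def)
qed

section \<open>Copies of family members as edge patterns\<close>

text \<open>A diamond with a pendant edge at \<open>c\<close>. Exchanging the names \<open>c\<close>
  and \<open>d\<close> covers the other vertex of degree two.\<close>

definition has_kite :: "'a graph \<Rightarrow> bool" where
  "has_kite G \<longleftrightarrow> (\<exists>a b c d w. distinct [a, b, c, d, w] \<and>
     {a, b} \<in> edges G \<and> {a, c} \<in> edges G \<and> {b, c} \<in> edges G \<and> {a, d} \<in> edges G \<and> {b, d} \<in> edges G \<and>
     {c, w} \<in> edges G)"

lemma edges_cycle_graph_4: "edges (cycle_graph 4) = {{0, 1}, {1, 2}, {2, 3}, {3, 0}}"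
proof -
  have "{..<4::nat} = {0, 1, 2, 3}" by auto
  then show ?thesis by (simp add: cycle_graph_def flip: numeral_2_eq_2)
qed

lemma theta_graphs_4:
  "theta_graphs 4 = {({..<4}, {{0, 2}, {0, 1}, {1, 2}, {2, 3}, {3, 0}}), ({..<4}, {{1, 3}, {0, 1}, {1, 2}, {2, 3}, {3, 0}})}"
proof -
  have four: "u < 4 \<longleftrightarrow> u = 0 \<or> u = 1 \<or> u = 2 \<or> u = 3" for u :: nat by auto
  have chord: "u < 4 \<and> v < 4 \<and> u \<noteq> v \<and> {u, v} \<notin> {{0, 1}, {1, 2}, {2, 3}, {3, 0}} \<longleftrightarrow>
      (u, v) \<in> {(0, 2), (2, 0), (1, 3), (3, 1)}" for u v :: nat
    unfolding four by (auto simp: doubleton_eq_iff)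
  have V: "verts (cycle_graph 4) = {..<4}" by (simp add: cycle_graph_def)
  define F where "F u v = ({..<4::nat}, insert {u, v} {{0, 1}, {1, 2}, {2, 3}, {3, 0}})" for u v :: nat
  have "theta_graphs 4 = {F u v | u v. (u, v) \<in> {(0, 2), (2, 0), (1, 3), (3, 1)}}"
    unfolding theta_graphs_def edges_cycle_graph_4 V lessThan_iff chord F_def ..
  also have "\<dots> = {F 0 2, F 2 0, F 1 3, F 3 1}" by blast
  also have "\<dots> = {F 0 2, F 1 3}"
  proof -
    have "F 2 0 = F 0 2" "F 3 1 = F 1 3" by (simp_all add: F_def insert_commute)
    then show ?thesis by simp
  qed
  finally show ?thesis by (simp add: F_def)
qed

lemma vertex_degree_theta:
  fixes v :: nat
  assumes "v < 4"
  shows "vertex_degree ({..<4}, {{0, 2}, {0, 1}, {1, 2}, {2, 3}, {3, 0}}) v = 2 \<longleftrightarrow> v = 1 \<or> v = 3" (is "?A \<longleftrightarrow> _")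
    and "vertex_degree ({..<4}, {{1, 3}, {0, 1}, {1, 2}, {2, 3}, {3, 0}}) v = 2 \<longleftrightarrow> v = 0 \<or> v = 2" (is "?B \<longleftrightarrow> _")
proof -
  have v: "v = 0 \<or> v = 1 \<or> v = 2 \<or> v = 3" using assms by auto
  have A: "{e \<in> {{0, 2}, {0, 1}, {1, 2}, {2, 3}, {3, 0}}. v \<in> e} =
    (if v = 0 then {{0, 2}, {0, 1}, {3, 0}} else if v = 1 then {{0, 1}, {1, 2}}
     else if v = 2 then {{0, 2}, {1, 2}, {2, 3}} else {{2, 3}, {3, 0}})"
    using v by (elim disjE) auto
  have B: "{e \<in> {{1, 3}, {0, 1}, {1, 2}, {2, 3}, {3, 0}}. v \<in> e} =
    (if v = 1 then {{1, 3}, {0, 1}, {1, 2}} else if v = 0 then {{0, 1}, {3, 0}}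
     else if v = 3 then {{1, 3}, {2, 3}, {3, 0}} else {{1, 2}, {2, 3}})"
    using v by (elim disjE) auto
  show "?A \<longleftrightarrow> v = 1 \<or> v = 3"
    unfolding vertex_degree_def snd_conv A using v by (elim disjE) (auto simp: doubleton_eq_iff)
  show "?B \<longleftrightarrow> v = 0 \<or> v = 2"
    unfolding vertex_degree_def snd_conv B using v by (elim disjE) (auto simp: doubleton_eq_iff)
qed

text \<open>Either labelled representative gives the pattern with its chord as
  \<open>{a, b}\<close>; conversely, the representative with chord \<open>{0, 2}\<close> can always
  be embedded.\<close>

lemma contains_diamond_iff:
  fixes G :: "'a graph"
  assumes G: "simple_graph G"
  shows "(\<exists>H\<in>theta_graphs 4. contains_copy G H) \<longleftrightarrow> has_diamond G"
proof
  assume "\<exists>H\<in>theta_graphs 4. contains_copy G H"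
  then obtain H f where H: "H \<in> theta_graphs 4" and f: "inj_on f (verts H)" "\<forall>e\<in>edges H. f ` e \<in> edges G"
    unfolding contains_copy_def by blast
  have "verts H = {..<4}" using H by (auto simp: theta_graphs_4)
  then have ne: "f i \<noteq> f j" if "i < 4" "j < 4" "i \<noteq> j" for i j
    using f(1) that by (auto dest: inj_onD)
  consider "edges H = {{0, 2}, {0, 1}, {1, 2}, {2, 3}, {3, 0}}" | "edges H = {{1, 3}, {0, 1}, {1, 2}, {2, 3}, {3, 0}}"
    using H by (auto simp: theta_graphs_4)
  then show "has_diamond G"
  proof cases
    case 1
    show ?thesis unfolding has_diamond_def
      by (rule exI[of _ "f 0"], rule exI[of _ "f 2"], rule exI[of _ "f 1"], rule exI[of _ "f 3"])
        (use f(2) ne in \<open>simp add: 1 insert_commute\<close>)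
  next
    case 2
    show ?thesis unfolding has_diamond_def
      by (rule exI[of _ "f 1"], rule exI[of _ "f 3"], rule exI[of _ "f 0"], rule exI[of _ "f 2"])
        (use f(2) ne in \<open>simp add: 2 insert_commute\<close>)
  qed
next
  assume "has_diamond G"
  then obtain a b c d where d: "distinct [a, b, c, d]" and e: "{a, b} \<in> edges G" "{a, c} \<in> edges G"
    "{b, c} \<in> edges G" "{a, d} \<in> edges G" "{b, d} \<in> edges G" unfolding has_diamond_def by blast
  have V: "a \<in> verts G" "b \<in> verts G" "c \<in> verts G" "d \<in> verts G"
    using simple_graph_edge_subset[OF G e(1)] simple_graph_edge_subset[OF G e(2)] simple_graph_edge_subset[OF G e(4)] by auto
  define f where "f i = (if i = 0 then a else if i = 1 then c else if i = 2 then b else d)" for i :: nat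
  have four: "{..<4::nat} = {0, 1, 2, 3}" by auto
  have "contains_copy G ({..<4}, {{0, 2}, {0, 1}, {1, 2}, {2, 3}, {3::nat, 0}})"
    unfolding contains_copy_def four
    by (rule exI[of _ f]) (use d e V in \<open>auto simp: f_def insert_commute\<close>)
  then show "\<exists>H\<in>theta_graphs 4. contains_copy G H" unfolding theta_graphs_4 by blast
qed

text \<open>The family is infinite, as the pendant vertex may carry any label
  \<open>w \<ge> 4\<close>. The forward direction treats all labels at once, with one case for each
  of the two vertices off the chord of either representative; the converse uses the label 4.\<close>

lemma contains_kite_iff:
  fixes G :: "'a graph"
  assumes G: "simple_graph G"
  shows "(\<exists>H\<in>theta_plus_graphs 4. contains_copy G H) \<longleftrightarrow> has_kite G"
proof
  assume "\<exists>H\<in>theta_plus_graphs 4. contains_copy G H"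
  then obtain T H f where T: "T \<in> theta_graphs 4" "H \<in> pendant_extensions T"
    and f: "inj_on f (verts H)" "\<forall>e\<in>edges H. f ` e \<in> edges G"
    unfolding contains_copy_def theta_plus_graphs_def by blast
  then obtain v w where H: "H = (insert w (verts T), insert {v, w} (edges T))"
    "v \<in> verts T" "vertex_degree T v = 2" "w \<notin> verts T" unfolding pendant_extensions_def by blast
  have VT: "verts T = {..<4}" using T by (auto simp: theta_graphs_4)
  have injw: "inj_on f (insert w {..<4})" using f(1) unfolding H(1) VT by simp
  have v: "v < 4" and w: "4 \<le> w" using H VT by auto
  let ?K = "\<lambda>a b c d. {f a, f b} \<in> edges G \<and> {f a, f c} \<in> edges G \<and> {f b, f c} \<in> edges G \<and>
      {f a, f d} \<in> edges G \<and> {f b, f d} \<in> edges G \<and> {f c, f w} \<in> edges G"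
  have kite: "has_kite G" if "?K a b c d" "distinct [a, b, c, d]" "a < 4" "b < 4" "c < 4" "d < 4" for a b c d
  proof -
    have "inj_on f (set [a, b, c, d, w])"
      by (rule inj_on_subset[OF injw]) (use that(3-6) in auto)
    moreover have "distinct [a, b, c, d, w]" using that(2-6) w by auto
    ultimately have "distinct (map f [a, b, c, d, w])" by (simp only: distinct_map)
    then have "distinct [f a, f b, f c, f d, f w]" by (simp only: list.map)
    then show ?thesis unfolding has_kite_def using that(1) by blast
  qed
  consider "T = ({..<4}, {{0, 2}, {0, 1}, {1, 2}, {2, 3}, {3, 0}})" | "T = ({..<4}, {{1, 3}, {0, 1}, {1, 2}, {2, 3}, {3, 0}})"
    using T by (auto simp: theta_graphs_4)
  then show "has_kite G"
  proof cases
    case 1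
    then consider "v = 1" | "v = 3" using H(3) vertex_degree_theta(1)[OF v] by auto
    then show ?thesis
    proof cases
      case 1 then show ?thesis using f(2) unfolding H(1) \<open>T = _\<close> by (intro kite[of 0 2 1 3]) (auto simp: insert_commute)
    next
      case 2 then show ?thesis using f(2) unfolding H(1) \<open>T = _\<close> by (intro kite[of 0 2 3 1]) (auto simp: insert_commute)
    qed
  next
    case 2
    then consider "v = 0" | "v = 2" using H(3) vertex_degree_theta(2)[OF v] by auto
    then show ?thesis
    proof cases
      case 1 then show ?thesis using f(2) unfolding H(1) \<open>T = _\<close> by (intro kite[of 1 3 0 2]) (auto simp: insert_commute)
    next
      case 2 then show ?thesis using f(2) unfolding H(1) \<open>T = _\<close> by (intro kite[of 1 3 2 0]) (auto simp: insert_commute)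
    qed
  qed
next
  assume "has_kite G"
  then obtain a b c d w where d: "distinct [a, b, c, d, w]" and e: "{a, b} \<in> edges G" "{a, c} \<in> edges G"
    "{b, c} \<in> edges G" "{a, d} \<in> edges G" "{b, d} \<in> edges G" "{c, w} \<in> edges G" unfolding has_kite_def by blast
  have V: "a \<in> verts G" "b \<in> verts G" "c \<in> verts G" "d \<in> verts G" "w \<in> verts G"
    using simple_graph_edge_subset[OF G e(1)] simple_graph_edge_subset[OF G e(6)] simple_graph_edge_subset[OF G e(4)] by auto
  define f where "f i = (if i = 0 then a else if i = 1 then c else if i = 2 then b else if i = 3 then d else w)" for i :: nat
  have four: "{..<4::nat} = {0, 1, 2, 3}" by auto
  let ?T = "({..<4}, {{0, 2}, {0, 1}, {1, 2}, {2, 3}, {3, 0}}) :: nat graph"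
  have "contains_copy G (insert 4 (verts ?T), insert {1, 4} (edges ?T))"
    unfolding contains_copy_def four
    by (rule exI[of _ f]) (use d e V in \<open>auto simp: f_def insert_commute\<close>)
  moreover have "(insert 4 (verts ?T), insert {1, 4} (edges ?T)) \<in> pendant_extensions ?T"
    unfolding pendant_extensions_def mem_Collect_eq
    by (rule exI[of _ 1], rule exI[of _ 4]) (use vertex_degree_theta(1)[of 1] in simp)
  moreover have "?T \<in> theta_graphs 4" unfolding theta_graphs_4 by simp
  ultimately show "\<exists>H\<in>theta_plus_graphs 4. contains_copy G H" unfolding theta_plus_graphs_def by blast
qed

section \<open>Deleting vertices and counting edges\<close>

definition del_verts :: "'a set \<Rightarrow> 'a graph \<Rightarrow> 'a graph" where
  "del_verts S G = (verts G - S, {e \<in> edges G. e \<inter> S = {}})"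

lemma planar_subgraph:
  assumes "planar_graph G" "V \<subseteq> verts G" "E \<subseteq> edges G" "\<And>e. e \<in> E \<Longrightarrow> e \<subseteq> V"
  shows "planar_graph (V, E)"
proof -
  obtain p \<gamma> where dr: "plane_drawing G p \<gamma>" using assms(1) by (auto simp: planar_graph_def)
  have "path_image (\<gamma> e) \<inter> p ` V = p ` e" if "e \<in> E" for e
  proof -
    have "path_image (\<gamma> e) \<inter> p ` verts G = p ` e"
      using dr subsetD[OF assms(3) that] unfolding plane_drawing_def by metis
    then have "path_image (\<gamma> e) \<inter> p ` verts G \<inter> p ` V = p ` e \<inter> p ` V" by simp
    moreover have "p ` verts G \<inter> p ` V = p ` V" using image_mono[OF assms(2), of p] by (rule Int_absorb1)
    moreover have "p ` e \<inter> p ` V = p ` e" using image_mono[OF assms(4)[OF that], of p] by (rule Int_absorb2)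
    ultimately show ?thesis by (simp only: Int_assoc)
  qed
  moreover have "inj_on p V" using dr assms(2) inj_on_subset by (auto simp: plane_drawing_def)
  ultimately have "plane_drawing (V, E) p \<gamma>"
    using dr assms(3) unfolding plane_drawing_def fst_conv snd_conv by (simp add: subset_iff)
  then show ?thesis by (auto simp: planar_graph_def)
qed

lemma simple_del_verts: "simple_graph G \<Longrightarrow> simple_graph (del_verts S G)"
  by (auto simp: simple_graph_def del_verts_def)

lemma planar_del_verts: "simple_graph G \<Longrightarrow> planar_graph G \<Longrightarrow> planar_graph (del_verts S G)"
  unfolding del_verts_def by (rule planar_subgraph) (auto simp: simple_graph_def)

lemma has_diamond_mono: "edges G \<subseteq> edges G' \<Longrightarrow> has_diamond G \<Longrightarrow> has_diamond G'"
  unfolding has_diamond_def by (meson subsetD)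

lemma has_kite_mono: "edges G \<subseteq> edges G' \<Longrightarrow> has_kite G \<Longrightarrow> has_kite G'"
  unfolding has_kite_def by (meson subsetD)

lemma edges_del_verts_subset: "edges (del_verts S G) \<subseteq> edges G"
  by (auto simp: del_verts_def)

lemma has_kite_imp_has_diamond: "has_kite G \<Longrightarrow> has_diamond G"
  unfolding has_kite_def has_diamond_def by (metis distinct_length_2_or_more distinct_singleton)

lemma card_edges_del_verts:
  assumes "simple_graph G"
  shows "card (edges G) = card (edges (del_verts S G)) + card {e \<in> edges G. e \<inter> S \<noteq> {}}"
proof -
  let ?A = "edges (del_verts S G)" and ?B = "{e \<in> edges G. e \<inter> S \<noteq> {}}"
  have "finite ?A" "finite ?B" "?A \<inter> ?B = {}"
    using simple_graph_finite_edges[OF assms] by (auto simp: del_verts_def)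
  then have "card (?A \<union> ?B) = card ?A + card ?B" by (rule card_Un_disjoint)
  moreover have "?A \<union> ?B = edges G" by (auto simp: del_verts_def)
  ultimately show ?thesis by simp
qed

lemma card_verts_del_verts:
  assumes "simple_graph G" "S \<subseteq> verts G"
  shows "card (verts (del_verts S G)) = card (verts G) - card S"
proof -
  have "finite S" using assms by (auto simp: simple_graph_def intro: finite_subset)
  then show ?thesis using assms(2) by (simp add: del_verts_def card_Diff_subset)
qed

lemma card_edges_le_choose:
  assumes "simple_graph G"
  shows "card (edges G) \<le> card (verts G) choose 2"
proof -
  have fin: "finite (verts G)" using assms by (simp add: simple_graph_def)
  have "edges G \<subseteq> {e. e \<subseteq> verts G \<and> card e = 2}" using assms by (auto simp: simple_graph_def)
  moreover have "finite {e. e \<subseteq> verts G \<and> card e = 2}" using fin by simp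
  ultimately have "card (edges G) \<le> card {e. e \<subseteq> verts G \<and> card e = 2}" by (rule card_mono[rotated])
  then show ?thesis using n_subsets[OF fin, of 2] by simp
qed

text \<open>The handshake lemma, by double counting of incidences.\<close>

lemma sum_vertex_degree:
  assumes "simple_graph G"
  shows "(\<Sum>v\<in>verts G. vertex_degree G v) = 2 * card (edges G)"
proof -
  have "card {v \<in> verts G. v \<in> e} = 2" if "e \<in> edges G" for e
  proof -
    have "{v \<in> verts G. v \<in> e} = e" using assms that by (auto simp: simple_graph_def)
    then show ?thesis using assms that by (simp add: simple_graph_def)
  qed
  then have "(\<Sum>v\<in>verts G. card {e \<in> edges G. v \<in> e}) = (\<Sum>e\<in>edges G. 2)"
    using assms simple_graph_finite_edges[OF assms] by (intro sum_multicount_gen) (auto simp: simple_graph_def)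
  then show ?thesis by (simp add: vertex_degree_def)
qed

text \<open>Some degree is at most the average; the product form avoids division.\<close>

lemma exists_low_degree:
  assumes "simple_graph G" "verts G \<noteq> {}"
  obtains v where "v \<in> verts G" "card (verts G) * vertex_degree G v \<le> 2 * card (edges G)"
proof -
  have "\<exists>v\<in>verts G. card (verts G) * vertex_degree G v \<le> 2 * card (edges G)"
  proof (rule ccontr)
    assume "\<not> ?thesis"
    then have *: "2 * card (edges G) < card (verts G) * vertex_degree G v" if "v \<in> verts G" for v
      using that by (simp add: not_le)
    have fin: "finite (verts G)" using assms(1) by (simp add: simple_graph_def)
    have "(\<Sum>v\<in>verts G. 2 * card (edges G)) < (\<Sum>v\<in>verts G. card (verts G) * vertex_degree G v)"
      using * assms(2) fin by (intro sum_strict_mono) auto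
    also have "\<dots> = card (verts G) * (2 * card (edges G))"
      by (simp add: sum_vertex_degree[OF assms(1)] flip: sum_distrib_left)
    finally show False by simp
  qed
  then show ?thesis using that by blast
qed

text \<open>Degrees of at most two would give, by the handshake lemma, no more edges than
  vertices.\<close>

lemma exists_degree_three:
  assumes "simple_graph G" "card (verts G) < card (edges G)"
  obtains v where "v \<in> verts G" "3 \<le> vertex_degree G v"
proof -
  have "\<exists>v\<in>verts G. 3 \<le> vertex_degree G v"
  proof (rule ccontr)
    assume "\<not> ?thesis"
    then have "vertex_degree G v \<le> 2" if "v \<in> verts G" for v using that by force
    then have "(\<Sum>v\<in>verts G. vertex_degree G v) \<le> (\<Sum>v\<in>verts G. 2)" by (intro sum_mono) auto
    then show False using sum_vertex_degree[OF assms(1)] assms(2) by simp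
  qed
  then show ?thesis using that by blast
qed

lemma card_le_one_subset_singleton:
  assumes "finite D" "card D \<le> 1"
  shows "\<exists>m. D \<subseteq> {m}"
proof (cases "D = {}")
  case False
  then have "card D = 1" using assms by (simp add: card_gt_0_iff order_antisym Suc_leI)
  then obtain m where "D = {m}" by (rule card_1_singletonE)
  then show ?thesis by auto
qed simp

text \<open>At most one of the six pairs is missing. The two vertices outside the missing pair are
  joined to each other and to everything else, so they form the shared edge of a diamond.\<close>

lemma five_edges_on_four_vertices:
  assumes G: "simple_graph G" and V: "card (verts G) = 4" and E: "5 \<le> card (edges G)"
  shows "has_diamond G"
proof -
  let ?P = "{e. e \<subseteq> verts G \<and> card e = 2}"
  have fin: "finite (verts G)" using G by (simp add: simple_graph_def)
  have sub: "edges G \<subseteq> ?P" using G by (auto simp: simple_graph_def)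
  have "card ?P = 4 choose 2" using n_subsets[OF fin, of 2] V by simp
  then have P6: "card ?P = 6" by (simp add: choose_two)
  then have "card (?P - edges G) \<le> 1"
    using sub E card_Diff_subset[of "edges G" ?P] simple_graph_finite_edges[OF G] by auto
  moreover have "finite (?P - edges G)" using fin by simp
  ultimately have "\<exists>m. ?P - edges G \<subseteq> {m}" by (rule card_le_one_subset_singleton[rotated])
  then obtain m0 where m0: "?P - edges G \<subseteq> {m0}" ..
  \<comment> \<open>If no pair is missing, an arbitrary pair takes the place of the missing
    one.\<close>
  obtain m where m: "m \<in> ?P" "?P - edges G \<subseteq> {m}"
  proof (cases "m0 \<in> ?P")
    case True then show ?thesis using that m0 by blast
  next
    case False
    have "?P \<noteq> {}" using P6 by (intro notI) simp
    then obtain m where "m \<in> ?P" by (meson ex_in_conv)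
    moreover have "?P - edges G \<subseteq> {m}" using False m0 by auto
    ultimately show ?thesis by (rule that)
  qed
  then obtain x y where xy: "m = {x, y}" "x \<noteq> y" by (auto simp: card_2_iff)
  have "m \<subseteq> verts G" "finite m" "card m = 2" using m xy by auto
  then have "card (verts G - m) = 2" using V by (simp add: card_Diff_subset)
  then obtain a b where ab: "verts G - m = {a, b}" "a \<noteq> b" by (auto simp: card_2_iff)
  have ne: "a \<notin> m" "b \<notin> m" "a \<in> verts G" "b \<in> verts G" "x \<in> verts G" "y \<in> verts G" using ab m xy by auto
  have edge: "{s, t} \<in> edges G" if "s \<in> verts G - m" "t \<in> verts G" "s \<noteq> t" for s t
  proof -
    have "{s, t} \<in> ?P" using that by auto
    moreover have "{s, t} \<noteq> m" using that by auto
    ultimately show ?thesis using m(2) by blast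
  qed
  have d: "distinct [a, b, x, y]" using ne ab(2) xy by auto
  have "{a, b} \<in> edges G" "{a, x} \<in> edges G" "{b, x} \<in> edges G" "{a, y} \<in> edges G" "{b, y} \<in> edges G"
    by (rule edge; use ne d in simp)+
  then show ?thesis unfolding has_diamond_def using d by blast
qed

text \<open>With \<open>m \<ge> 7\<close> edges, deleting a vertex of at most average degree
  \<open>2 * m / 5\<close> leaves at least \<open>3 * m / 5 > 4\<close> edges on four vertices,
  hence a diamond.\<close>

lemma five_vertices_diamond_free:
  assumes G: "simple_graph G" and V: "card (verts G) = 5" and nd: "\<not> has_diamond G"
  shows "card (edges G) \<le> 6"
proof (rule ccontr)
  assume "\<not> ?thesis"
  then have E: "7 \<le> card (edges G)" by simp
  obtain v where v: "v \<in> verts G" "5 * vertex_degree G v \<le> 2 * card (edges G)"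
    by (rule exists_low_degree[OF G]) (use V in force)+
  have "{e \<in> edges G. e \<inter> {v} \<noteq> {}} = {e \<in> edges G. v \<in> e}" by auto
  then have "card (edges G) = card (edges (del_verts {v} G)) + vertex_degree G v"
    using card_edges_del_verts[OF G, of "{v}"] by (simp add: vertex_degree_def)
  then have "5 \<le> card (edges (del_verts {v} G))" using v(2) E by linarith
  moreover have "card (verts (del_verts {v} G)) = 4" using card_verts_del_verts[OF G, of "{v}"] v V by simp
  ultimately have "has_diamond (del_verts {v} G)"
    using five_edges_on_four_vertices simple_del_verts[OF G] by blast
  then show False using nd has_diamond_mono[OF edges_del_verts_subset] by blast
qed

section \<open>Local structure of kite-free graphs and the extension step\<close>

text \<open>Every vertex of degree two of a diamond carries no further edge if there is no kite, and in
  \<open>K\<^sub>4\<close> every vertex plays this role.\<close>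

lemma kite_free_diamond_cases:
  assumes G: "simple_graph G" and nk: "\<not> has_kite G" and "has_diamond G"
  obtains (pair) c d where "c \<in> verts G" "d \<in> verts G" "c \<noteq> d" "vertex_degree G c \<le> 2" "vertex_degree G d \<le> 2"
  | (clique) S where "S \<subseteq> verts G" "card S = 4" "card {e \<in> edges G. e \<inter> S \<noteq> {}} \<le> 6"
proof -
  obtain a b c d where d: "distinct [a, b, c, d]" and e: "{a, b} \<in> edges G" "{a, c} \<in> edges G"
    "{b, c} \<in> edges G" "{a, d} \<in> edges G" "{b, d} \<in> edges G" using assms(3) unfolding has_diamond_def by blast
  have V: "a \<in> verts G" "b \<in> verts G" "c \<in> verts G" "d \<in> verts G"
    using simple_graph_edge_subset[OF G e(1)] simple_graph_edge_subset[OF G e(2)] simple_graph_edge_subset[OF G e(4)] by auto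
  have nbrs: "w \<in> {x, y, t}" if "{x, y} \<in> edges G" "{x, s} \<in> edges G" "{y, s} \<in> edges G" "{x, t} \<in> edges G" "{y, t} \<in> edges G"
    "{s, w} \<in> edges G" "distinct [x, y, s, t]" for x y s t w
  proof (rule ccontr)
    assume "w \<notin> {x, y, t}"
    moreover have "card {s, w} = 2" using G that(6) by (simp add: simple_graph_def)
    then have "s \<noteq> w" by auto
    ultimately have "distinct [x, y, s, t, w]" using that(7) by auto
    then show False using nk that(1-6) unfolding has_kite_def by blast
  qed
  show ?thesis
  proof (cases "{c, d} \<in> edges G")
    case False
    have "vertex_degree G s \<le> 2" if "s \<in> {c, d}" for s
    proof -
      have "{f \<in> edges G. s \<in> f} \<subseteq> {{s, a}, {s, b}}"
      proof
        fix f assume f: "f \<in> {f \<in> edges G. s \<in> f}"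
        then obtain w where w: "f = {s, w}" using simple_graph_edge_other[OF G, of f s] by auto
        have sw: "{s, w} \<in> edges G" using f w by simp
        have "w \<in> {a, b, c, d} - {s}"
        proof (cases "s = c")
          case True
          have "w \<in> {a, b, d}" using nbrs[of a b c d w] e sw d True by simp
          then show ?thesis using d True by auto
        next
          case False
          then have "s = d" using that by simp
          have "w \<in> {a, b, c}" using nbrs[of a b d c w] e sw d \<open>s = d\<close> by auto
          then show ?thesis using d \<open>s = d\<close> by auto
        qed
        moreover have "{s, w} \<noteq> {c, d}" using False sw by auto
        ultimately show "f \<in> {{s, a}, {s, b}}" using w that by auto
      qed
      then have "card {f \<in> edges G. s \<in> f} \<le> card {{s, a}, {s, b}}" by (intro card_mono) auto
      also have "\<dots> \<le> 2" by (simp add: card_insert_if)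
      finally show ?thesis by (simp add: vertex_degree_def)
    qed
    then show ?thesis using pair[of c d] V d by auto
  next
    case True
    let ?S = "{a, b, c, d}"
    have nbS: "w \<in> ?S" if "s \<in> ?S" "{s, w} \<in> edges G" for s w
    proof -
      have e': "{b, a} \<in> edges G" "{c, a} \<in> edges G" "{c, b} \<in> edges G" "{d, a} \<in> edges G" "{d, b} \<in> edges G" "{d, c} \<in> edges G"
        using e True by (simp_all add: insert_commute)
      have "w \<in> {a, b, d}" if "{c, w} \<in> edges G" using nbrs[of a b c d w] e that d by simp
      moreover have "w \<in> {a, b, c}" if "{d, w} \<in> edges G" using nbrs[of a b d c w] e that d by auto
      moreover have "w \<in> {c, d, b}" if "{a, w} \<in> edges G" using nbrs[of c d a b w] e e' True that d by auto
      moreover have "w \<in> {c, d, a}" if "{b, w} \<in> edges G" using nbrs[of c d b a w] e e' True that d by auto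
      ultimately show ?thesis using that by blast
    qed
    \<comment> \<open>As a list of length six it bounds the number of edges without a proof that its
      entries are distinct.\<close>
    let ?L = "[{a, b}, {a, c}, {a, d}, {b, c}, {b, d}, {c, d}]"
    have "{f \<in> edges G. f \<inter> ?S \<noteq> {}} \<subseteq> set ?L"
    proof
      fix f assume f: "f \<in> {f \<in> edges G. f \<inter> ?S \<noteq> {}}"
      then obtain s where s: "s \<in> f" "s \<in> ?S" by blast
      then obtain w where w: "f = {s, w}" "w \<noteq> s" using simple_graph_edge_other[OF G, of f s] f by blast
      then have "w \<in> ?S" using nbS[OF s(2), of w] f by auto
      then show "f \<in> set ?L" using s(2) w by (auto simp: insert_commute)
    qed
    then have "card {f \<in> edges G. f \<inter> ?S \<noteq> {}} \<le> card (set ?L)" by (intro card_mono) auto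
    also have "\<dots> \<le> 6" using card_length[of ?L] by simp
    finally show ?thesis using clique[of ?S] V d by auto
  qed
qed

text \<open>A new vertex joined to two nonadjacent vertices of a common face lies in no triangle.\<close>

lemma diamond_free_extension:
  fixes G :: "nat graph"
  assumes G: "simple_graph G" and pl: "planar_graph G" and nd: "\<not> has_diamond G"
    and big: "card (verts G) < card (edges G)"
  obtains G' :: "nat graph" where "simple_graph G'" "planar_graph G'" "\<not> has_diamond G'"
    "card (verts G') = Suc (card (verts G))" "card (edges G') = card (edges G) + 2"
proof -
  obtain p \<gamma>0 where dr0: "plane_drawing G p \<gamma>0" using pl by (auto simp: planar_graph_def)
  obtain x where x: "x \<in> verts G" "3 \<le> vertex_degree G x" using exists_degree_three[OF G big] .
  obtain \<gamma> u w h where dr: "plane_drawing G p \<gamma>" and uw: "u \<in> verts G" "w \<in> verts G" "u \<noteq> w" and nuw: "{u, w} \<notin> edges G"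
    and h: "arc h" "pathstart h = p u" "pathfinish h = p w" "path_image h \<inter> drawing_set G p \<gamma> = {p u, p w}"
    using nonadjacent_on_common_face[OF G dr0 nd x(2)] by metis
  have fin: "finite (verts G)" using G by (simp add: simple_graph_def)
  obtain z where z: "z \<notin> verts G" using fin ex_new_if_finite infinite_UNIV_nat by blast
  define G' where "G' = (insert z (verts G), insert {u, z} (insert {w, z} (edges G)))"
  have "planar_graph G'" unfolding G'_def by (rule planar_add_degree_two_vertex[OF G dr uw z h])
  moreover have "simple_graph G'" using G uw z by (auto simp: G'_def simple_graph_def card_2_iff)
  moreover have "\<not> has_diamond G'"
  proof
    assume "has_diamond G'"
    have zE: "z \<notin> e" if "e \<in> edges G" for e using simple_graph_edge_subset[OF G that] z by auto
    have old: "{s, t} \<in> edges G" if "{s, t} \<in> edges G'" "s \<noteq> z" "t \<noteq> z" for s t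
      using that by (auto simp: G'_def doubleton_eq_iff)
    have zn: "t = u \<or> t = w" if "{z, t} \<in> edges G'" for t
      using that zE[of "{z, t}"] uw z by (auto simp: G'_def doubleton_eq_iff)
    have tri: "z \<noteq> r" if "{r, s} \<in> edges G'" "{r, t} \<in> edges G'" "{s, t} \<in> edges G'" "r \<noteq> s" "r \<noteq> t" "s \<noteq> t" for r s t
    proof
      assume "z = r"
      then have "{s, t} = {u, w}" using zn[of s] zn[of t] that by auto
      moreover have "{s, t} \<in> edges G" using old that \<open>z = r\<close> by blast
      ultimately show False using nuw by simp
    qed
    obtain a b c d where d: "distinct [a, b, c, d]" and e: "{a, b} \<in> edges G'" "{a, c} \<in> edges G'"
      "{b, c} \<in> edges G'" "{a, d} \<in> edges G'" "{b, d} \<in> edges G'" using \<open>has_diamond G'\<close> unfolding has_diamond_def by blast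
    have e': "{b, a} \<in> edges G'" "{c, a} \<in> edges G'" "{c, b} \<in> edges G'" "{d, a} \<in> edges G'" "{d, b} \<in> edges G'"
      using e by (simp_all add: insert_commute)
    \<comment> \<open>Every vertex of a diamond lies on one of its triangles, so a diamond of the
      new graph avoids \<open>z\<close> and is already present in \<open>G\<close>.\<close>
    have "z \<noteq> a" "z \<noteq> b" "z \<noteq> c" "z \<noteq> d"
      using tri[of a b c] tri[of b a c] tri[of c a b] tri[of d a b] e e' d by auto
    then have "has_diamond G" unfolding has_diamond_def using old e d by blast
    then show False using nd by simp
  qed
  moreover have "card (verts G') = Suc (card (verts G))" using z fin by (simp add: G'_def)
  moreover have "card (edges G') = card (edges G) + 2"
  proof -
    have "{u, z} \<notin> edges G" "{w, z} \<notin> edges G" using simple_graph_edge_subset[OF G] z by auto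
    moreover have "{u, z} \<noteq> {w, z}" using uw(3) by (auto simp: doubleton_eq_iff)
    ultimately show ?thesis using simple_graph_finite_edges[OF G] by (simp add: G'_def)
  qed
  ultimately show ?thesis using that by blast
qed

section \<open>Extremal numbers and their recurrences\<close>

lemma finite_ex_planar_set:
  "finite {card (edges G) | G :: nat graph. simple_graph G \<and> card (verts G) = n \<and> planar_graph G \<and>
     (\<forall>H\<in>\<F>. \<not> contains_copy G H)}"
proof (rule finite_subset)
  show "{card (edges G) | G :: nat graph. simple_graph G \<and> card (verts G) = n \<and> planar_graph G \<and>
     (\<forall>H\<in>\<F>. \<not> contains_copy G H)} \<subseteq> {..n choose 2}"
    unfolding subset_iff mem_Collect_eq atMost_iff by (metis card_edges_le_choose)
qed simp

lemma ex_planar_ge: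
  fixes G :: "nat graph"
  assumes "simple_graph G" "planar_graph G" "\<forall>H\<in>\<F>. \<not> contains_copy G H"
  shows "card (edges G) \<le> ex_planar (card (verts G)) \<F>"
  unfolding ex_planar_def by (rule Max_ge[OF finite_ex_planar_set]) (use assms in blast)

text \<open>\<open>Max\<close> is a member only of a nonempty set; the hypothesis makes the edgeless
  graph admissible, which supplies an element for every \<open>n\<close>.\<close>

lemma ex_planar_attained:
  assumes "\<And>G :: nat graph. edges G = {} \<Longrightarrow> simple_graph G \<Longrightarrow> \<forall>H\<in>\<F>. \<not> contains_copy G H"
  obtains G :: "nat graph" where "simple_graph G" "planar_graph G" "card (verts G) = n"
    "\<forall>H\<in>\<F>. \<not> contains_copy G H" "card (edges G) = ex_planar n \<F>"
proof -
  let ?A = "{card (edges G) | G :: nat graph. simple_graph G \<and> card (verts G) = n \<and> planar_graph G \<and>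
     (\<forall>H\<in>\<F>. \<not> contains_copy G H)}"
  let ?G = "({..<n}, {}) :: nat graph"
  have "simple_graph ?G" by (simp add: simple_graph_def)
  moreover have "plane_drawing ?G of_nat (\<lambda>_. linepath 0 0)" by (simp add: plane_drawing_def inj_on_def)
  then have "planar_graph ?G" unfolding planar_graph_def by blast
  moreover have "\<forall>H\<in>\<F>. \<not> contains_copy ?G H" using assms[of ?G] \<open>simple_graph ?G\<close> by simp
  moreover have "card (verts ?G) = n" by simp
  ultimately have "?A \<noteq> {}" by blast
  then have "ex_planar n \<F> \<in> ?A" unfolding ex_planar_def by (rule Max_in[OF finite_ex_planar_set])
  then show ?thesis using that by auto
qed

lemma ex_theta_ge:
  fixes G :: "nat graph"
  assumes "simple_graph G" "planar_graph G" "\<not> has_diamond G"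
  shows "card (edges G) \<le> ex_planar (card (verts G)) (theta_graphs 4)"
  using ex_planar_ge[OF assms(1,2)] contains_diamond_iff[OF assms(1)] assms(3) by blast

lemma ex_theta_plus_ge:
  fixes G :: "nat graph"
  assumes "simple_graph G" "planar_graph G" "\<not> has_kite G"
  shows "card (edges G) \<le> ex_planar (card (verts G)) (theta_plus_graphs 4)"
  using ex_planar_ge[OF assms(1,2)] contains_kite_iff[OF assms(1)] assms(3) by blast

lemma edgeless_free:
  assumes "edges G = {}"
  shows "\<not> has_diamond G" "\<not> has_kite G"
  using assms by (auto simp: has_diamond_def has_kite_def)

lemma ex_theta_attained:
  obtains G :: "nat graph" where "simple_graph G" "planar_graph G" "card (verts G) = n"
    "\<not> has_diamond G" "card (edges G) = ex_planar n (theta_graphs 4)"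
proof -
  have "\<forall>H\<in>theta_graphs 4. \<not> contains_copy G H" if "edges G = {}" "simple_graph G" for G :: "nat graph"
    using contains_diamond_iff[OF that(2)] edgeless_free(1)[OF that(1)] by blast
  from ex_planar_attained[OF this, of n] obtain G :: "nat graph" where G: "simple_graph G" "planar_graph G"
    "card (verts G) = n" "\<forall>H\<in>theta_graphs 4. \<not> contains_copy G H" "card (edges G) = ex_planar n (theta_graphs 4)"
    by blast
  moreover have "\<not> has_diamond G" using contains_diamond_iff[OF G(1)] G(4) by blast
  ultimately show ?thesis using that by blast
qed

lemma ex_theta_plus_attained:
  obtains G :: "nat graph" where "simple_graph G" "planar_graph G" "card (verts G) = n"
    "\<not> has_kite G" "card (edges G) = ex_planar n (theta_plus_graphs 4)"
proof -
  have "\<forall>H\<in>theta_plus_graphs 4. \<not> contains_copy G H" if "edges G = {}" "simple_graph G" for G :: "nat graph"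
    using contains_kite_iff[OF that(2)] edgeless_free(2)[OF that(1)] by blast
  from ex_planar_attained[OF this, of n] obtain G :: "nat graph" where G: "simple_graph G" "planar_graph G"
    "card (verts G) = n" "\<forall>H\<in>theta_plus_graphs 4. \<not> contains_copy G H" "card (edges G) = ex_planar n (theta_plus_graphs 4)"
    by blast
  moreover have "\<not> has_kite G" using contains_kite_iff[OF G(1)] G(4) by blast
  ultimately show ?thesis using that by blast
qed

lemma ex_theta_le_ex_theta_plus: "ex_planar n (theta_graphs 4) \<le> ex_planar n (theta_plus_graphs 4)"
proof -
  obtain G :: "nat graph" where G: "simple_graph G" "planar_graph G" "card (verts G) = n" "\<not> has_diamond G"
    "card (edges G) = ex_planar n (theta_graphs 4)" by (rule ex_theta_attained)
  have "\<not> has_kite G" using G(4) has_kite_imp_has_diamond by blast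
  then show ?thesis using ex_theta_plus_ge[OF G(1,2)] G(3,5) by simp
qed

lemma ex_theta_plus_le_choose: "ex_planar n (theta_plus_graphs 4) \<le> n choose 2"
proof -
  obtain G :: "nat graph" where "simple_graph G" "card (verts G) = n" "card (edges G) = ex_planar n (theta_plus_graphs 4)"
    by (rule ex_theta_plus_attained)
  then show ?thesis using card_edges_le_choose by metis
qed

lemma card_edges_le_del_verts:
  fixes G :: "nat graph"
  assumes "simple_graph G" "planar_graph G" "\<not> has_kite G" "S \<subseteq> verts G"
  shows "card (edges G) \<le> ex_planar (card (verts G) - card S) (theta_plus_graphs 4) + card {e \<in> edges G. e \<inter> S \<noteq> {}}"
proof -
  have "\<not> has_kite (del_verts S G)" using has_kite_mono[OF edges_del_verts_subset] assms(3) by blast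
  then have "card (edges (del_verts S G)) \<le> ex_planar (card (verts (del_verts S G))) (theta_plus_graphs 4)"
    by (rule ex_theta_plus_ge[OF simple_del_verts[OF assms(1)] planar_del_verts[OF assms(1,2)]])
  then show ?thesis using card_edges_del_verts[OF assms(1), of S] card_verts_del_verts[OF assms(1,4)] by simp
qed

text \<open>Applied to an extremal kite-free graph. The \<open>pair\<close> case records two
  estimates: deleting one vertex serves the induction from 6 on, while at \<open>n = 5\<close> both
  are deleted, because the trivial bound 6 for four vertices would yield 8 instead of 7.\<close>

lemma ex_theta_plus_cases:
  obtains (free) "ex_planar n (theta_plus_graphs 4) \<le> ex_planar n (theta_graphs 4)"
  | (pair) "ex_planar n (theta_plus_graphs 4) \<le> ex_planar (n - 1) (theta_plus_graphs 4) + 2"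
      "ex_planar n (theta_plus_graphs 4) \<le> ex_planar (n - 2) (theta_plus_graphs 4) + 4"
  | (clique) "ex_planar n (theta_plus_graphs 4) \<le> ex_planar (n - 4) (theta_plus_graphs 4) + 6" "4 \<le> n"
proof -
  obtain G :: "nat graph" where G: "simple_graph G" "planar_graph G" "card (verts G) = n" "\<not> has_kite G"
    "card (edges G) = ex_planar n (theta_plus_graphs 4)" by (rule ex_theta_plus_attained)
  note del = card_edges_le_del_verts[OF G(1,2,4), unfolded G(3,5)]
  show ?thesis
  proof (cases "has_diamond G")
    case False
    then show ?thesis using free ex_theta_ge[OF G(1,2)] G(3,5) by simp
  next
    case True
    from G(1,4) True show ?thesis
    proof (cases rule: kite_free_diamond_cases)
      case (pair c d)
      have "{e \<in> edges G. e \<inter> {c} \<noteq> {}} = {e \<in> edges G. c \<in> e}" by auto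
      then have 1: "card {e \<in> edges G. e \<inter> {c} \<noteq> {}} \<le> 2" using pair(4) by (simp add: vertex_degree_def)
      have "{e \<in> edges G. e \<inter> {c, d} \<noteq> {}} = {e \<in> edges G. c \<in> e} \<union> {e \<in> edges G. d \<in> e}" by auto
      then have 2: "card {e \<in> edges G. e \<inter> {c, d} \<noteq> {}} \<le> 4"
        using pair(4,5) card_Un_le[of "{e \<in> edges G. c \<in> e}" "{e \<in> edges G. d \<in> e}"] by (simp add: vertex_degree_def)
      have c1: "card {c} = 1" "{c} \<subseteq> verts G" and c2: "card {c, d} = 2" "{c, d} \<subseteq> verts G"
        using pair(1-3) by auto
      have "ex_planar n (theta_plus_graphs 4) \<le> ex_planar (n - 1) (theta_plus_graphs 4) + 2"
        using del[OF c1(2)] 1 unfolding c1(1) by linarith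
      moreover have "ex_planar n (theta_plus_graphs 4) \<le> ex_planar (n - 2) (theta_plus_graphs 4) + 4"
        using del[OF c2(2)] 2 unfolding c2(1) by linarith
      ultimately show ?thesis by (rule that(2))
    next
      case (clique S)
      have "4 \<le> n" using clique(1,2) G(1,3) card_mono[of "verts G" S] by (simp add: simple_graph_def)
      then show ?thesis using that(3) del[of S] clique by simp
    qed
  qed
qed

text \<open>The hypothesis gives an extremal graph more edges than vertices, hence the vertex of
  degree three around which the extension is made.\<close>

lemma ex_theta_Suc_ge:
  assumes "n < ex_planar n (theta_graphs 4)"
  shows "ex_planar n (theta_graphs 4) + 2 \<le> ex_planar (Suc n) (theta_graphs 4)"
proof -
  obtain G :: "nat graph" where G: "simple_graph G" "planar_graph G" "card (verts G) = n" "\<not> has_diamond G"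
    "card (edges G) = ex_planar n (theta_graphs 4)" by (rule ex_theta_attained)
  obtain G' :: "nat graph" where G': "simple_graph G'" "planar_graph G'" "\<not> has_diamond G'"
    "card (verts G') = Suc (card (verts G))" "card (edges G') = card (edges G) + 2"
    by (rule diamond_free_extension[OF G(1,2,4)]) (use assms G in auto)
  show ?thesis using ex_theta_ge[OF G'(1-3)] G' G by simp
qed

section \<open>The prism, the book and the small extremal numbers\<close>

lemma simple_prism: "simple_graph prism"
  by (auto simp: simple_graph_def prism_def)

lemma card_edges_prism: "card (edges prism) = 9"
  by (simp add: prism_def doubleton_eq_iff)

text \<open>\<open>x div 3\<close> names the triangle and \<open>x mod 3\<close> the position in it;
  matching edges preserve the position.\<close>

lemma prism_edge:
  assumes "{x, y} \<in> edges prism"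
  shows "x < 6" "x div 3 = y div 3 \<or> x mod 3 = y mod 3"
  using assms by (auto simp: prism_def doubleton_eq_iff)

text \<open>There are only two classes of \<open>div 3\<close>. If the vertices were not all in one
  class, the one alone in its class would share its position with the other two, which would then
  coincide.\<close>

lemma prism_triangle:
  assumes "{x, y} \<in> edges prism" "{x, z} \<in> edges prism" "{y, z} \<in> edges prism" "x \<noteq> y" "x \<noteq> z" "y \<noteq> z"
  shows "x div 3 = y div 3" "x div 3 = z div 3"
proof -
  have lt: "x < 6" "y < 6" "z < 6"
    using assms(1-3) prism_edge(1)[of x y] prism_edge(1)[of y z] prism_edge(1)[of z x] by (auto simp: insert_commute)
  have eqI: "s = t" if "s div 3 = t div 3" "s mod 3 = t mod 3" for s t :: nat
    using that by (metis div_mult_mod_eq)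
  have two: "s div 3 = 0 \<or> s div 3 = 1" if "s < 6" for s :: nat using that by auto
  show "x div 3 = y div 3" "x div 3 = z div 3"
    using prism_edge(2)[OF assms(1)] prism_edge(2)[OF assms(2)] prism_edge(2)[OF assms(3)]
      two[OF lt(1)] two[OF lt(2)] two[OF lt(3)] eqI[of x y] eqI[of x z] eqI[of y z] assms(4-6) by metis+
qed

text \<open>Both triangles of a diamond contain \<open>a\<close>, so all four vertices would lie in
  the same class of \<open>div 3\<close>, which has three elements.\<close>

lemma prism_diamond_free: "\<not> has_diamond prism"
proof
  assume "has_diamond prism"
  then obtain a b c d where d: "distinct [a, b, c, d]" and e: "{a, b} \<in> edges prism" "{a, c} \<in> edges prism"
    "{b, c} \<in> edges prism" "{a, d} \<in> edges prism" "{b, d} \<in> edges prism" unfolding has_diamond_def by blast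
  define k where "k = a div 3"
  have "a div 3 = b div 3" "a div 3 = c div 3" using prism_triangle[OF e(1,2,3)] d by auto
  moreover have "a div 3 = d div 3" using prism_triangle[OF e(1,4,5)] d by auto
  ultimately have k: "a div 3 = k" "b div 3 = k" "c div 3 = k" "d div 3 = k" by (simp_all add: k_def)
  have "x \<in> {3 * k, 3 * k + 1, 3 * k + 2}" if "x div 3 = k" for x using that by auto
  then have "set [a, b, c, d] \<subseteq> {3 * k, 3 * k + 1, 3 * k + 2}" using k by simp
  then have "card (set [a, b, c, d]) \<le> card {3 * k, 3 * k + 1, 3 * k + 2}" by (intro card_mono) auto
  moreover have "card (set [a, b, c, d]) = 4" using distinct_card[OF d] by simp
  ultimately show False by simp
qed

lemma simple_book3: "simple_graph book3"
  by (auto simp: simple_graph_def book3_def)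

lemma card_edges_book3: "card (edges book3) = 7"
  by (simp add: book3_def doubleton_eq_iff)

text \<open>The vertices 0 and 1 meet every edge of the book, but no two vertices meet every edge of
  a kite: the triangle \<open>a b c\<close> needs two of its own vertices, and each choice misses
  one of \<open>{c, w}\<close>, \<open>{b, d}\<close>, \<open>{a, d}\<close>.\<close>

lemma book3_kite_free: "\<not> has_kite book3"
proof
  assume "has_kite book3"
  then obtain a b c d w where d: "distinct [a, b, c, d, w]" and e: "{a, b} \<in> edges book3" "{a, c} \<in> edges book3"
    "{b, c} \<in> edges book3" "{a, d} \<in> edges book3" "{b, d} \<in> edges book3" "{c, w} \<in> edges book3" unfolding has_kite_def by blast
  have cover: "x = 0 \<or> x = 1 \<or> y = 0 \<or> y = 1" if "{x, y} \<in> edges book3" for x y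
    using that by (auto simp: book3_def doubleton_eq_iff)
  show False using cover[OF e(1)] cover[OF e(2)] cover[OF e(3)] cover[OF e(4)] cover[OF e(5)] cover[OF e(6)] d by auto
qed

lemma ex_theta_6_ge: "9 \<le> ex_planar 6 (theta_graphs 4)"
  using ex_theta_ge[OF simple_prism planar_prism prism_diamond_free] by (simp add: card_edges_prism) (simp add: prism_def)

text \<open>The lower bound comes from the prism with one vertex deleted, which keeps 9 - 3
  edges.\<close>

lemma ex_theta_5: "ex_planar 5 (theta_graphs 4) = 6"
proof (rule antisym)
  obtain G :: "nat graph" where "simple_graph G" "card (verts G) = 5" "\<not> has_diamond G"
    "card (edges G) = ex_planar 5 (theta_graphs 4)" by (rule ex_theta_attained)
  then show "ex_planar 5 (theta_graphs 4) \<le> 6" using five_vertices_diamond_free by metis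
next
  let ?H = "del_verts {5} prism"
  have "{e \<in> edges prism. e \<inter> {5} \<noteq> {}} = {{3, 5}, {4, 5}, {2, 5}}" by (auto simp: prism_def)
  then have "card {e \<in> edges prism. e \<inter> {5} \<noteq> {}} = 3" by (simp add: doubleton_eq_iff)
  then have "card (edges ?H) = 6" using card_edges_del_verts[OF simple_prism, of "{5}"] card_edges_prism by simp
  moreover have "card (verts ?H) = 5" using card_verts_del_verts[OF simple_prism, of "{5}"] by (simp add: prism_def)
  moreover have "\<not> has_diamond ?H" using has_diamond_mono[OF edges_del_verts_subset] prism_diamond_free by blast
  ultimately show "6 \<le> ex_planar 5 (theta_graphs 4)"
    using ex_theta_ge[OF simple_del_verts[OF simple_prism] planar_del_verts[OF simple_prism planar_prism]] by metis
qed

text \<open>The three cases give at most 6, 3 + 4 and 0 + 6; the book attains 7.\<close>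

lemma ex_theta_plus_5: "ex_planar 5 (theta_plus_graphs 4) = 7"
proof (rule antisym)
  show "ex_planar 5 (theta_plus_graphs 4) \<le> 7"
  proof (cases rule: ex_theta_plus_cases[of 5])
    case free then show ?thesis by (simp add: ex_theta_5)
  next
    case pair then show ?thesis using ex_theta_plus_le_choose[of 3] by (simp add: choose_two)
  next
    case clique then show ?thesis using ex_theta_plus_le_choose[of 1] by (simp add: choose_two)
  qed
next
  have "card (edges book3) \<le> ex_planar (card (verts book3)) (theta_plus_graphs 4)"
    by (rule ex_theta_plus_ge[OF simple_book3 planar_book3 book3_kite_free])
  then show "7 \<le> ex_planar 5 (theta_plus_graphs 4)" unfolding card_edges_book3 by (simp add: book3_def)
qed

section \<open>The induction\<close>

text \<open>The prism gives equality of \<open>2 * n - 3\<close> with 9 at \<open>n = 6\<close>.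
  Since \<open>2 * n - 3\<close> exceeds \<open>n\<close> in this range, the extension step always
  applies and adds two.\<close>

lemma ex_theta_ge_linear: "6 \<le> n \<Longrightarrow> 2 * n - 3 \<le> ex_planar n (theta_graphs 4)"
proof (induction n rule: nat_induct_at_least)
  case base then show ?case using ex_theta_6_ge by simp
next
  case (Suc n)
  then have "n < ex_planar n (theta_graphs 4)" by linarith
  have "2 * Suc n - 3 \<le> (2 * n - 3) + 2" by simp
  also have "\<dots> \<le> ex_planar n (theta_graphs 4) + 2" using Suc.IH by (rule add_right_mono)
  also have "\<dots> \<le> ex_planar (Suc n) (theta_graphs 4)" by (rule ex_theta_Suc_ge) fact
  finally show ?case .
qed

lemma ex_theta_Suc_ge': "6 \<le> n \<Longrightarrow> ex_planar n (theta_graphs 4) + 2 \<le> ex_planar (Suc n) (theta_graphs 4)"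
  using ex_theta_ge_linear[of n] by (intro ex_theta_Suc_ge) linarith

lemma ex_theta_plus_le_ex_theta:
  "6 \<le> n \<Longrightarrow> ex_planar n (theta_plus_graphs 4) \<le> ex_planar n (theta_graphs 4)"
proof (induction n rule: less_induct)
  case (less n)
  let ?f = "\<lambda>n. ex_planar n (theta_graphs 4)"
  let ?g = "\<lambda>n. ex_planar n (theta_plus_graphs 4)"
  show ?case
  proof (cases rule: ex_theta_plus_cases[of n])
    case free then show ?thesis .
  next
    case pair
    show ?thesis
    proof (cases "n = 6")
      \<comment> \<open>The induction hypothesis does not reach 5, where the inequality is false;
        \<open>g 5 + 2 = 9\<close> is just matched by the prism.\<close>
      case True then show ?thesis using pair(1) ex_theta_plus_5 ex_theta_6_ge by simp
    next
      case False
      then have "?g (n - 1) \<le> ?f (n - 1)" using less by simp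
      moreover have "?f (n - 1) + 2 \<le> ?f n" using ex_theta_Suc_ge'[of "n - 1"] False less.prems by simp
      ultimately show ?thesis using pair(1) by simp
    qed
  next
    case clique
    \<comment> \<open>For \<open>n\<close> from 6 to 9 the bounds 1, 3, 6, 7 on
      \<open>g (n - 4)\<close> give 7, 9, 12, 13, below the values 9, 11, 13, 15 of
      \<open>2 * n - 3\<close>. At \<open>n = 9\<close> the exact value \<open>g 5 = 7\<close> is
      needed, since the trivial bound 10 would give 16.\<close>
    consider "n = 6" | "n = 7" | "n = 8" | "n = 9" | "10 \<le> n" using less.prems by linarith
    then show ?thesis
    proof cases
      case 5
      define m where "m = n - 4"
      have m: "6 \<le> m" "n = Suc (Suc (Suc (Suc m)))" using 5 by (simp_all add: m_def)
      have "?g m \<le> ?f m" using less m by simp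
      moreover have "?f m + 8 \<le> ?f n"
        unfolding m(2) using ex_theta_Suc_ge'[of m] ex_theta_Suc_ge'[of "Suc m"] ex_theta_Suc_ge'[of "Suc (Suc m)"]
          ex_theta_Suc_ge'[of "Suc (Suc (Suc m))"] m(1) by simp
      ultimately show ?thesis using clique(1) unfolding m_def by simp
    qed (use clique(1) ex_theta_ge_linear[of n] ex_theta_plus_le_choose[of "n - 4"] ex_theta_plus_5
      in \<open>simp_all add: choose_two\<close>)
  qed
qed

theorem theorem5p3:
  fixes n :: nat
  assumes "n \<ge> 5"
  shows "(n \<ge> 6 \<longrightarrow> ex_planar n (theta_plus_graphs 4) = ex_planar n (theta_graphs 4)) \<and>
         ex_planar 5 (theta_plus_graphs 4) = ex_planar 5 (theta_graphs 4) + 1 \<and>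
         ex_planar 5 (theta_graphs 4) + 1 = 7"
  using ex_theta_plus_le_ex_theta[of n] ex_theta_le_ex_theta_plus[of n]
  by (simp add: ex_theta_5 ex_theta_plus_5)

end
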